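(* Let $G=\mathbb{Z}/n\mathbb{Z}$ with $n\geq 3$, and let $m$ be any integer with $1\leq m<n$. If $m$ is even, define $$S_m:=\{\pm1,\pm2,\dots,\pm m/2\}\subset\widehat{G},$$ and if $m$ is odd, define $$S_m:=\{\pm1,\pm2,\dots,\pm(m-1)/2,\;(m+1)/2\}\subset\widehat{G}$$ (so $S_1=\{1\}$), where integers represent characters of $G$. In either case, $$\beta^{\mathbf{r}}_{\mathrm{field}}(G,S_m)=\gamma^{\mathbf{r}}_{\mathrm{field}}(G,S_m)=\max\left(3,\left\lceil\frac{n}{\lceil m/2\rceil}\right\rceil\right).$$
   Context: Let $\mathbf{k}$ be a field with $\operatorname{char}\mathbf{k}\nmid n$ containing $n$ distinct $n$th roots of unity, and fix a primitive $n$th root of unity $\zeta\in\mathbf{k}$ (when $\mathbf{k}=\mathbb{C}$, $\zeta=e^{2\pi i/n}$). $\widehat G$ is the character group of $G$. An integer $k$ represents the character $\ell\mapsto\zeta^{k\ell}$ of $G=\mathbb{Z}/n\mathbb{Z}$. For a finite-dimensional representation $V$ of $G$ over $\mathbf{k}$: $\mathbf{k}[V]$ is the polynomial ring of $V$ (the symmetric algebra of $V^*$, with its induced $G$-action), $\mathbf{k}(V)$ is its fraction field, and $\mathbf{k}(V)^G$ is the field of invariant rational functions. For $f\in\mathbf{k}(V)$ written as $f=f_1/f_2$ with $f_1,f_2\in\mathbf{k}[V]$ and $\gcd(f_1,f_2)=1$, the degree of $f$ is $\deg f:=\deg f_1+\deg f_2$ (constants, including $0$, have degree $0$). $\mathbf{k}(V)^G_{\leq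 d}$ is the set of invariant rational functions of degree $\leq d$. Define, with minima over positive integers $d$, $$\beta^{\mathbf{r}}_{\mathrm{field}}(G,V):=\min\{d:\mathbf{k}(V)^G\text{ is generated as a field (over }\mathbf{k})\text{ by }\mathbf{k}(V)^G_{\leq d}\},$$ $$\gamma^{\mathbf{r}}_{\mathrm{field}}(G,V):=\min\{d:\mathbf{k}(V)^G_{\leq d}\text{ contains a transcendence basis for }\mathbf{k}(V)^G\text{ over }\mathbf{k}\}.$$ For a set $S$ of integers representing distinct nontrivial characters, $\beta^{\mathbf{r}}_{\mathrm{field}}(G,S):=\beta^{\mathbf{r}}_{\mathrm{field}}(G,V)$ and $\gamma^{\mathbf{r}}_{\mathrm{field}}(G,S):=\gamma^{\mathbf{r}}_{\mathrm{field}}(G,V)$, where $V$ is any finite-dimensional representation of $G$ over $\mathbf{k}$ such that the set of distinct nontrivial characters occurring in $V^*$ is the set represented by $S$ (these quantities depend only on $S$). *)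

theory Defs
  imports
    "HOL-Algebra.Algebraic_Closure_Type"
    "HOL-Algebra.Elementary_Groups"
    "HOL-Algebra.Generated_Fields"
    "HOL-Analysis.Cartesian_Space"
    "HOL-Computational_Algebra.Fraction_Field"
    "HOL-Library.Poly_Mapping"
begin

section \<open>Polynomials and rational functions\<close>

text \<open>
  Polynomials over \<open>'k\<close> in variables indexed by \<open>'v\<close>; a monomial is its exponent map
  \<open>'v \<Rightarrow>\<^sub>0 nat\<close>. The \<open>linorder\<close> constraints on \<open>'v\<close> below come from the library's \<open>idom\<close>
  instance for \<open>\<Rightarrow>\<^sub>0\<close>, which \<open>fract\<close> needs; no definition refers to the order.
\<close>

type_synonym ('v, 'k) mpoly = "('v \<Rightarrow>\<^sub>0 nat) \<Rightarrow>\<^sub>0 'k"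

type_synonym ('v, 'k) ratfun = "('v, 'k) mpoly fract"

definition mpoly_const :: "'k::zero \<Rightarrow> ('v, 'k) mpoly" where
  "mpoly_const c = Poly_Mapping.single 0 c"

definition mpoly_var :: "'v \<Rightarrow> ('v, 'k::zero_neq_one) mpoly" where
  "mpoly_var i = Poly_Mapping.single (Poly_Mapping.single i 1) 1"

text \<open>Evaluation at \<open>a\<close>, with coefficients mapped to the target ring by \<open>\<phi>\<close>.\<close>

definition mpoly_eval :: "('k::zero \<Rightarrow> 'b::comm_semiring_1) \<Rightarrow> ('v \<Rightarrow> 'b) \<Rightarrow> ('v, 'k) mpoly \<Rightarrow> 'b" where
  "mpoly_eval \<phi> a p =
     (\<Sum>m\<in>Poly_Mapping.keys p. \<phi> (Poly_Mapping.lookup p m) *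
        (\<Prod>i\<in>Poly_Mapping.keys m. a i ^ Poly_Mapping.lookup m i))"

definition mpoly_degree :: "('v, 'k::zero) mpoly \<Rightarrow> nat" where
  "mpoly_degree p =
     Max (insert 0 ((\<lambda>m. \<Sum>i\<in>Poly_Mapping.keys m. Poly_Mapping.lookup m i) ` Poly_Mapping.keys p))"

text \<open>
  The library's \<open>coprime\<close> requires a division operation, which \<open>mpoly\<close> does not have;
  this is its defining property.
\<close>

definition mpoly_coprime :: "('v, 'k::comm_semiring_1) mpoly \<Rightarrow> ('v, 'k) mpoly \<Rightarrow> bool" where
  "mpoly_coprime p q \<longleftrightarrow> (\<forall>c. c dvd p \<longrightarrow> c dvd q \<longrightarrow> c dvd 1)"

text \<open>
  Numerator and denominator of a reduced fraction are unique up to a common unit, so the set under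
  \<open>LEAST\<close> has exactly one element.
\<close>

definition ratfun_degree :: "('v::linorder, 'k::field) ratfun \<Rightarrow> nat" where
  "ratfun_degree f =
     (LEAST d. \<exists>p q. q \<noteq> 0 \<and> mpoly_coprime p q \<and> f = Fract p q \<and> d = mpoly_degree p + mpoly_degree q)"

definition ratfun_const :: "'k::field \<Rightarrow> ('v::linorder, 'k) ratfun" where
  "ratfun_const c = Fract (mpoly_const c) 1"

definition adjoin :: "('v::linorder, 'k::field) ratfun set \<Rightarrow> ('v, 'k) ratfun set" where
  "adjoin A = generate_field ring_of_type_algebra (range ratfun_const \<union> A)"

text \<open>The polynomial variables are indexed by rational functions and evaluated at themselves.\<close>

definition algebraically_independent :: "('v::linorder, 'k::field) ratfun set \<Rightarrow> bool" where
  "algebraically_independent T \<longleftrightarrow>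
     (\<forall>P :: (('v, 'k) ratfun, 'k) mpoly.
        (\<forall>m\<in>Poly_Mapping.keys P. Poly_Mapping.keys m \<subseteq> T) \<longrightarrow>
        mpoly_eval ratfun_const id P = 0 \<longrightarrow> P = 0)"

definition transcendence_basis ::
    "('v::linorder, 'k::field) ratfun set \<Rightarrow> ('v, 'k) ratfun set \<Rightarrow> bool" where
  "transcendence_basis T L \<longleftrightarrow>
     T \<subseteq> L \<and> algebraically_independent T \<and>
     (\<forall>f\<in>L. ring.algebraic ring_of_type_algebra (adjoin T) f)"

section \<open>Representations and invariant rational functions\<close>

text \<open>
  A finite-dimensional representation is given in coordinates, as a homomorphism \<open>\<rho>\<close> from \<open>G\<close> to
  \<open>GL\<close> acting on the column vectors \<open>'k ^ 'v\<close>. A linear form on \<open>'k ^ 'v\<close> is a row vector.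
\<close>

definition GL :: "('k::field ^ 'v ^ 'v) monoid" where
  "GL = \<lparr>carrier = {A. invertible A}, monoid.mult = (**), one = mat 1\<rparr>"

text \<open>The contragredient action \<open>(g \<cdot> l)(v) = l (g\<inverse> v)\<close>.\<close>

definition dual_action ::
    "('g, 'a) monoid_scheme \<Rightarrow> ('g \<Rightarrow> 'k::field ^ 'v ^ 'v) \<Rightarrow> 'g \<Rightarrow> 'k ^ 'v \<Rightarrow> 'k ^ 'v" where
  "dual_action G \<rho> g l = l v* \<rho> (inv\<^bsub>G\<^esub> g)"

definition linear_form :: "'k::field ^ 'v \<Rightarrow> ('v::finite, 'k) mpoly" where
  "linear_form l = (\<Sum>i\<in>UNIV. mpoly_const (l $ i) * mpoly_var i)"

text \<open>The variable \<open>i\<close> is the coordinate function \<open>axis i 1\<close>.\<close>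

definition mpoly_action ::
    "('g, 'a) monoid_scheme \<Rightarrow> ('g \<Rightarrow> 'k::field ^ 'v ^ 'v) \<Rightarrow> 'g \<Rightarrow> ('v::finite, 'k) mpoly \<Rightarrow> ('v, 'k) mpoly" where
  "mpoly_action G \<rho> g p = mpoly_eval mpoly_const (\<lambda>i. linear_form (dual_action G \<rho> g (axis i 1))) p"

text \<open>
  For a representation and \<open>g \<in> carrier G\<close> the result does not depend on the chosen fraction, as
  \<open>mpoly_action G \<rho> g\<close> is then a ring automorphism.
\<close>

definition ratfun_action ::
    "('g, 'a) monoid_scheme \<Rightarrow> ('g \<Rightarrow> 'k::field ^ 'v::{finite,linorder} ^ 'v::{finite,linorder}) \<Rightarrow> 'g \<Rightarrow>
     ('v, 'k) ratfun \<Rightarrow> ('v, 'k) ratfun" where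
  "ratfun_action G \<rho> g f =
     (THE h. \<exists>p q. q \<noteq> 0 \<and> f = Fract p q \<and> h = Fract (mpoly_action G \<rho> g p) (mpoly_action G \<rho> g q))"

definition invariants ::
    "('g, 'a) monoid_scheme \<Rightarrow> ('g \<Rightarrow> 'k::field ^ 'v::{finite,linorder} ^ 'v::{finite,linorder}) \<Rightarrow> ('v, 'k) ratfun set" where
  "invariants G \<rho> = {f. \<forall>g\<in>carrier G. ratfun_action G \<rho> g f = f}"

definition invariants_le ::
    "('g, 'a) monoid_scheme \<Rightarrow> ('g \<Rightarrow> 'k::field ^ 'v::{finite,linorder} ^ 'v::{finite,linorder}) \<Rightarrow> nat \<Rightarrow> ('v, 'k) ratfun set" where
  "invariants_le G \<rho> d = {f \<in> invariants G \<rho>. ratfun_degree f \<le> d}"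

text \<open>
  \<open>Inf\<close> of a nonempty set of natural numbers is its minimum; \<open>Inf {} = 0\<close>, so a positive value
  is an attained minimum.
\<close>

definition beta_field ::
    "('g, 'a) monoid_scheme \<Rightarrow> ('g \<Rightarrow> 'k::field ^ 'v::{finite,linorder} ^ 'v::{finite,linorder}) \<Rightarrow> nat" where
  "beta_field G \<rho> = Inf {d. 0 < d \<and> adjoin (invariants_le G \<rho> d) = invariants G \<rho>}"

definition gamma_field ::
    "('g, 'a) monoid_scheme \<Rightarrow> ('g \<Rightarrow> 'k::field ^ 'v::{finite,linorder} ^ 'v::{finite,linorder}) \<Rightarrow> nat" where
  "gamma_field G \<rho> =
     Inf {d. 0 < d \<and> (\<exists>T \<subseteq> invariants_le G \<rho> d. transcendence_basis T (invariants G \<rho>))}"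

section \<open>Characters\<close>

definition character_group :: "('g, 'a) monoid_scheme \<Rightarrow> ('g \<Rightarrow> 'k::field) set" where
  "character_group G = hom G (mult_of ring_of_type_algebra) \<inter> extensional (carrier G)"

definition trivial_character :: "('g, 'a) monoid_scheme \<Rightarrow> 'g \<Rightarrow> 'k::field" where
  "trivial_character G = (\<lambda>g\<in>carrier G. 1)"

definition dual_characters ::
    "('g, 'a) monoid_scheme \<Rightarrow> ('g \<Rightarrow> 'k::field ^ 'v ^ 'v) \<Rightarrow> ('g \<Rightarrow> 'k) set" where
  "dual_characters G \<rho> =
     {\<psi> \<in> character_group G. \<exists>l. l \<noteq> 0 \<and> (\<forall>g\<in>carrier G. dual_action G \<rho> g l = \<psi> g *s l)}"

definition primitive_root_of_unity :: "nat \<Rightarrow> 'k::field \<Rightarrow> bool" where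
  "primitive_root_of_unity n \<zeta> \<longleftrightarrow> 0 < n \<and> \<zeta> ^ n = 1 \<and> (\<forall>j. 0 < j \<and> j < n \<longrightarrow> \<zeta> ^ j \<noteq> 1)"

definition int_character :: "nat \<Rightarrow> 'k::field \<Rightarrow> int \<Rightarrow> int \<Rightarrow> 'k" where
  "int_character n \<zeta> k = (\<lambda>l\<in>carrier (integer_mod_group n). \<zeta> powi (k * l))"

definition S_set :: "nat \<Rightarrow> int set" where
  "S_set m =
     (if even m then {1..int m div 2} \<union> uminus ` {1..int m div 2}
      else {1..(int m - 1) div 2} \<union> uminus ` {1..(int m - 1) div 2} \<union> {(int m + 1) div 2})"

end

theory Submission
  imports Defs
begin

text \<open>
  The contragredient representation is diagonalizable: there are linear coordinates \<open>y i\<close> that a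
  group element \<open>g\<close> multiplies by \<open>\<zeta> powi (\<theta> i * g)\<close>, where the weights \<open>\<theta> i\<close> may be chosen in
  \<open>S_m \<union> {0}\<close> (\<open>exists_eigenbasis\<close>, \<open>interval_weights_of_dual_characters\<close>). In these coordinates a
  rational function is invariant iff it is a quotient of two polynomials all of whose monomials have
  the same weight modulo \<open>n\<close> (\<open>invariants_eq_wfield\<close>). Dividing both by a common monomial, one
  sees that the invariants are generated by the Laurent monomials \<open>y^e\<close> with \<open>e\<close> in the lattice
  of all integral vectors with \<open>n\<close> dividing \<open>\<Sum>i. \<theta> i * e i\<close>. The degree of \<open>y^e\<close> is at most the
  \<open>l\<^sub>1\<close>-norm of \<open>e\<close>, so both bounds are statements about short vectors of this lattice. Let \<open>M\<close> be
  \<open>m / 2\<close> rounded up, which is the largest weight, and let \<open>D\<close> be the maximum of 3 and \<open>n / M\<close>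
  rounded up.

  Upper bound: the lattice has a basis of vectors of norm at most \<open>D\<close>. If \<open>y_s\<close>
  denotes a coordinate of weight \<open>s\<close>, then the exponents of \<open>y_(s+1) / (y_s * y_1)\<close> have norm 3, those of
  \<open>y_s * y_(-s)\<close> and of quotients of coordinates of equal weight have norm 2, and they reduce every vector to a multiple of the unit vector of a coordinate of weight 1.
  What remains is \<open>n\<close> times that unit vector, and \<open>n = q * M + t\<close> with \<open>0 \<le> t < M\<close> represents it
  by \<open>q\<close> coordinates of weight \<open>M\<close> and at most one further coordinate
  (\<open>short_basis_norm\<close>, \<open>short_basis_generates\<close>). The Laurent monomials of a basis are
  algebraically independent and generate the field of invariants, which bounds both invariants of
  the representation at once.

  Lower bound: projecting numerator and denominator to one weight only removes monomials,
  so an invariant of degree at most \<open>d\<close> is a quotient in which the exponents of the numerator and of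
  the denominator differ by lattice vectors of norm at most \<open>d\<close>. If \<open>d * M < n\<close>, such a vector
  satisfies \<open>\<Sum>i. \<theta> i * e i = 0\<close> exactly and not only modulo \<open>n\<close>; if \<open>d \<le> 2\<close>, it contains
  coordinates of weight 1 and of weight -1 equally often. In both cases a linear functional \<open>\<omega>\<close> that
  does not vanish on a coordinate \<open>a\<close> of weight 1 vanishes on all short lattice vectors. Hence the
  invariants of degree at most \<open>d\<close> lie in the field of fractions of equal \<open>\<omega>\<close>-weight, and the
  invariant \<open>y_a ^ n\<close> is transcendental over that field (\<open>not_algebraic_over_wfield\<close>).
\<close>

section \<open>Substitution homomorphisms of polynomial rings\<close>

abbreviation lookup where "lookup \<equiv> Poly_Mapping.lookup"
abbreviation keys where "keys \<equiv> Poly_Mapping.keys"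

definition mon_eval :: "('v \<Rightarrow> 'b::comm_semiring_1) \<Rightarrow> ('v \<Rightarrow>\<^sub>0 nat) \<Rightarrow> 'b" where
  "mon_eval a m = (\<Prod>i\<in>keys m. a i ^ lookup m i)"

lemma mon_eval_superset:
  assumes "finite A" "keys m \<subseteq> A"
  shows "mon_eval a m = (\<Prod>i\<in>A. a i ^ lookup m i)"
  unfolding mon_eval_def
  by (rule prod.mono_neutral_left) (use assms in \<open>auto simp: in_keys_iff\<close>)

lemma mon_eval_UNIV: "mon_eval a (m :: 'v::finite \<Rightarrow>\<^sub>0 nat) = (\<Prod>i\<in>UNIV. a i ^ lookup m i)"
  by (rule mon_eval_superset) auto

lemma mon_eval_0 [simp]: "mon_eval a 0 = 1"
  by (simp add: mon_eval_def)

lemma mon_eval_add: "mon_eval a (m + m') = mon_eval a m * mon_eval a m'"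
proof -
  let ?A = "keys m \<union> keys m'"
  have "keys (m + m') \<subseteq> ?A" by (rule keys_add)
  then show ?thesis
    using mon_eval_superset[of ?A "m + m'" a] mon_eval_superset[of ?A m a] mon_eval_superset[of ?A m' a]
    by (simp add: lookup_add power_add prod.distrib)
qed

lemma mon_eval_single: "mon_eval a (Poly_Mapping.single i k) = a i ^ k"
  by (simp add: mon_eval_def)

lemma sum_single_lookup: "(\<Sum>m\<in>keys p. Poly_Mapping.single m (lookup p m)) = p"
proof (rule poly_mapping_eqI)
  fix k
  show "lookup (\<Sum>m\<in>keys p. Poly_Mapping.single m (lookup p m)) k = lookup p k"
    by (simp add: lookup_sum lookup_single when_def in_keys_iff)
qed

lemma mpoly_const_0 [simp]: "mpoly_const 0 = 0"
  and mpoly_const_1 [simp]: "mpoly_const 1 = 1"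
  and mpoly_const_add: "mpoly_const (c + d) = mpoly_const c + mpoly_const d"
  and mpoly_const_mult: "mpoly_const (c * d) = mpoly_const c * mpoly_const d"
  for c d :: "'k::comm_ring_1"
  by (simp_all add: mpoly_const_def single_add mult_single)

lemma mpoly_const_eq_0_iff [simp]: "mpoly_const c = 0 \<longleftrightarrow> c = 0"
  unfolding mpoly_const_def by (metis lookup_single_eq lookup_zero single_zero)

lemma mpoly_const_mult_single:
  "mpoly_const c * Poly_Mapping.single m (d :: 'k::comm_ring_1) = Poly_Mapping.single m (c * d)"
  by (simp add: mpoly_const_def mult_single)

lemma lookup_mpoly_const_mult: "lookup (mpoly_const (c :: 'k::comm_ring_1) * p) m = c * lookup p m"
proof -
  have "mpoly_const c * p = (\<Sum>m\<in>keys p. Poly_Mapping.single m (c * lookup p m))"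
    by (subst sum_single_lookup[of p, symmetric]) (simp add: sum_distrib_left mpoly_const_mult_single)
  then show ?thesis
    by (simp add: lookup_sum lookup_single when_def in_keys_iff)
qed

lemma single_eq_mon_eval:
  "Poly_Mapping.single m (c :: 'k::comm_ring_1) = mpoly_const c * mon_eval mpoly_var m"
proof -
  have pow: "mpoly_var i ^ k = Poly_Mapping.single (Poly_Mapping.single i k) (1::'k)" for i :: 'a and k
    by (induction k) (simp_all add: mpoly_var_def mult_single single_add[symmetric])
  have "(\<Prod>i\<in>A. mpoly_var i ^ lookup m i) =
      Poly_Mapping.single (\<Sum>i\<in>A. Poly_Mapping.single i (lookup m i)) (1::'k)" if "finite A" for A
    using that by (induction A) (simp_all add: pow mult_single)
  from this[of "keys m"] have "mon_eval mpoly_var m = Poly_Mapping.single m (1::'k)"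
    by (simp add: mon_eval_def sum_single_lookup)
  then show ?thesis by (simp add: mpoly_const_mult_single)
qed

definition psubst :: "('v \<Rightarrow> ('w, 'k::comm_ring_1) mpoly) \<Rightarrow> ('v, 'k) mpoly \<Rightarrow> ('w, 'k) mpoly" where
  "psubst = mpoly_eval mpoly_const"

lemma psubst_superset:
  assumes "finite A" "keys p \<subseteq> A"
  shows "psubst a p = (\<Sum>m\<in>A. mpoly_const (lookup p m) * mon_eval a m)"
  unfolding psubst_def mpoly_eval_def mon_eval_def[symmetric]
  by (rule sum.mono_neutral_left) (use assms in \<open>auto simp: in_keys_iff\<close>)

lemma psubst_keys: "psubst a p = (\<Sum>m\<in>keys p. mpoly_const (lookup p m) * mon_eval a m)"
  by (rule psubst_superset) auto

lemma psubst_0 [simp]: "psubst a 0 = 0"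
  by (simp add: psubst_keys)

lemma psubst_single: "psubst a (Poly_Mapping.single m c) = mpoly_const c * mon_eval a m"
  by (simp add: psubst_superset[of "{m}"])

lemma psubst_const [simp]: "psubst a (mpoly_const c) = mpoly_const c"
  by (simp add: mpoly_const_def psubst_single)

lemma psubst_1 [simp]: "psubst a 1 = 1"
  using psubst_const[of a 1] by simp

lemma psubst_var [simp]: "psubst a (mpoly_var i) = a i"
  by (simp add: mpoly_var_def psubst_single mon_eval_single)

lemma psubst_add: "psubst a (p + q) = psubst a p + psubst a q"
proof -
  let ?A = "keys p \<union> keys q"
  have "keys (p + q) \<subseteq> ?A" by (rule keys_add)
  then show ?thesis
    using psubst_superset[of ?A "p + q" a] psubst_superset[of ?A p a] psubst_superset[of ?A q a]
    by (simp add: lookup_add mpoly_const_add sum.distrib algebra_simps)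
qed

lemma psubst_sum: "psubst a (sum f A) = (\<Sum>x\<in>A. psubst a (f x))"
  by (induction A rule: infinite_finite_induct) (simp_all add: psubst_add)

lemma psubst_mult: "psubst a (p * q) = psubst a p * psubst a q"
proof -
  have "p * q = (\<Sum>m\<in>keys p. \<Sum>m'\<in>keys q. Poly_Mapping.single (m + m') (lookup p m * lookup q m'))"
    by (subst sum_single_lookup[of p, symmetric], subst sum_single_lookup[of q, symmetric])
       (simp add: sum_product mult_single)
  then show ?thesis
    by (simp add: psubst_sum psubst_single psubst_keys[of a p] psubst_keys[of a q] sum_product
        mpoly_const_mult mon_eval_add algebra_simps)
qed

lemma psubst_uminus: "psubst a (- p) = - psubst a p"
  using psubst_add[of a p "- p"] by (simp add: eq_neg_iff_add_eq_0 add.commute)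

lemma psubst_power: "psubst a (p ^ k) = psubst a p ^ k"
  by (induction k) (simp_all add: psubst_mult)

lemma psubst_prod: "psubst a (prod f A) = (\<Prod>x\<in>A. psubst a (f x))"
  by (induction A rule: infinite_finite_induct) (simp_all add: psubst_mult)

lemma psubst_mon_eval: "psubst a (mon_eval b m) = mon_eval (\<lambda>i. psubst a (b i)) m"
  by (simp add: mon_eval_def psubst_prod psubst_power)

text \<open>
  Substitutions compose like maps of the variables; this is what makes the coordinate change and the group
  action computable on linear forms.
\<close>

lemma psubst_psubst: "psubst a (psubst b p) = psubst (\<lambda>i. psubst a (b i)) p"
  by (simp add: psubst_keys[of b] psubst_keys[of "\<lambda>i. psubst a (b i)"] psubst_sum psubst_mult psubst_mon_eval)

lemma psubst_mpoly_var [simp]: "psubst mpoly_var p = p"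
  by (simp add: psubst_keys single_eq_mon_eval[symmetric] sum_single_lookup)

section \<open>Degree of a rational function\<close>

definition mdeg :: "('v \<Rightarrow>\<^sub>0 nat) \<Rightarrow> nat" where
  "mdeg m = (\<Sum>i\<in>keys m. lookup m i)"

lemma mdeg_superset:
  assumes "finite A" "keys m \<subseteq> A"
  shows "mdeg m = (\<Sum>i\<in>A. lookup m i)"
  unfolding mdeg_def by (rule sum.mono_neutral_left) (use assms in \<open>auto simp: in_keys_iff\<close>)

lemma mdeg_UNIV: "mdeg (m :: 'v::finite \<Rightarrow>\<^sub>0 nat) = (\<Sum>i\<in>UNIV. lookup m i)"
  by (rule mdeg_superset) auto

lemma mdeg_add: "mdeg (m + m') = mdeg m + mdeg m'"
proof -
  let ?A = "keys m \<union> keys m'"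
  have "keys (m + m') \<subseteq> ?A" by (rule keys_add)
  then show ?thesis
    using mdeg_superset[of ?A "m + m'"] mdeg_superset[of ?A m] mdeg_superset[of ?A m']
    by (simp add: lookup_add sum.distrib)
qed

lemma mdeg_eq_0_iff: "mdeg m = 0 \<longleftrightarrow> m = 0"
proof
  assume "mdeg m = 0"
  then have "lookup m i = 0" if "i \<in> keys m" for i using that by (simp add: mdeg_def)
  then show "m = 0" by (intro poly_mapping_eqI) (metis in_keys_iff lookup_zero)
qed (simp add: mdeg_def)

lemma mpoly_degree_le_iff: "mpoly_degree p \<le> d \<longleftrightarrow> (\<forall>m\<in>keys p. mdeg m \<le> d)"
  unfolding mpoly_degree_def mdeg_def[symmetric] by (subst Max_le_iff) auto

lemma mdeg_le_mpoly_degree: "m \<in> keys p \<Longrightarrow> mdeg m \<le> mpoly_degree p"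
  using mpoly_degree_le_iff[of p "mpoly_degree p"] by blast

lemma mpoly_degree_0 [simp]: "mpoly_degree 0 = 0"
  by (simp add: mpoly_degree_def)

lemma mpoly_degree_const [simp]: "mpoly_degree (mpoly_const c) = 0"
  using mpoly_degree_le_iff[of "mpoly_const c" 0]
  by (auto simp: mpoly_const_def mdeg_def split: if_splits)

lemma mpoly_degree_1 [simp]: "mpoly_degree (1 :: ('v, 'k::comm_ring_1) mpoly) = 0"
  unfolding mpoly_const_1[symmetric] by (rule mpoly_degree_const)

lemma mpoly_degree_attained:
  assumes "p \<noteq> 0" obtains m where "m \<in> keys p" "mdeg m = mpoly_degree p"
proof -
  have "mpoly_degree p = Max (mdeg ` keys p)"
    unfolding mpoly_degree_def mdeg_def[symmetric] using assms
    by (subst Max_insert) auto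
  moreover have "Max (mdeg ` keys p) \<in> mdeg ` keys p"
    using assms by (intro Max_in) auto
  ultimately show thesis using that by auto
qed

lemma mpoly_degree_add_le: "mpoly_degree (p + q) \<le> max (mpoly_degree p) (mpoly_degree q)"
  unfolding mpoly_degree_le_iff
proof
  fix m assume "m \<in> keys (p + q)"
  then have "m \<in> keys p \<or> m \<in> keys q" using keys_add[of p q] by blast
  then show "mdeg m \<le> max (mpoly_degree p) (mpoly_degree q)"
    using mdeg_le_mpoly_degree[of m p] mdeg_le_mpoly_degree[of m q] by linarith
qed

lemma mpoly_degree_sum_le:
  assumes "\<And>x. x \<in> A \<Longrightarrow> mpoly_degree (f x) \<le> d"
  shows "mpoly_degree (sum f A) \<le> d"
  using assms
proof (induction A rule: infinite_finite_induct)
  case (insert x A)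
  then show ?case using mpoly_degree_add_le[of "f x" "sum f A"] by fastforce
qed auto

lemma mpoly_degree_mult_le:
  "mpoly_degree (p * q) \<le> mpoly_degree p + mpoly_degree (q :: ('v, 'k::comm_ring_1) mpoly)"
  unfolding mpoly_degree_le_iff
proof
  fix m assume "m \<in> keys (p * q)"
  then obtain x y where "m = x + y" "x \<in> keys p" "y \<in> keys q" using keys_mult[of p q] by blast
  then show "mdeg m \<le> mpoly_degree p + mpoly_degree q"
    using mdeg_le_mpoly_degree[of x p] mdeg_le_mpoly_degree[of y q] by (simp add: mdeg_add)
qed

lemma mpoly_degree_power_le:
  fixes p :: "('v, 'k::comm_ring_1) mpoly"
  assumes "mpoly_degree p \<le> 1"
  shows "mpoly_degree (p ^ k) \<le> k"
proof (induction k)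
  case 0
  then show ?case by simp
next
  case (Suc k)
  then show ?case using mpoly_degree_mult_le[of p "p ^ k"] assms by simp
qed

lemma mpoly_degree_prod_le:
  fixes f :: "'a \<Rightarrow> ('v, 'k::comm_ring_1) mpoly"
  shows "mpoly_degree (prod f A) \<le> (\<Sum>x\<in>A. mpoly_degree (f x))"
proof (induction A rule: infinite_finite_induct)
  case (insert x A)
  then show ?case using mpoly_degree_mult_le[of "f x" "prod f A"] by simp
qed simp_all

lemma mpoly_degree_mon_eval_le:
  fixes a :: "'v \<Rightarrow> ('w, 'k::comm_ring_1) mpoly"
  assumes "\<And>i. mpoly_degree (a i) \<le> 1"
  shows "mpoly_degree (mon_eval a m) \<le> mdeg m"
  unfolding mon_eval_def mdeg_def
  by (rule order_trans[OF mpoly_degree_prod_le sum_mono]) (rule mpoly_degree_power_le[OF assms])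

lemma mpoly_degree_psubst_le:
  assumes "\<And>i. mpoly_degree (a i) \<le> 1"
  shows "mpoly_degree (psubst a p) \<le> mpoly_degree p"
  unfolding psubst_keys
proof (rule mpoly_degree_sum_le)
  fix m assume "m \<in> keys p"
  have "mpoly_degree (mpoly_const (lookup p m) * mon_eval a m) \<le> mdeg m"
    using mpoly_degree_mult_le[of "mpoly_const (lookup p m)" "mon_eval a m"]
      mpoly_degree_mon_eval_le[of a m, OF assms] by simp
  then show "mpoly_degree (mpoly_const (lookup p m) * mon_eval a m) \<le> mpoly_degree p"
    using mdeg_le_mpoly_degree[OF \<open>m \<in> keys p\<close>] by simp
qed

text \<open>
  The product of the homogeneous components of top degree does not vanish, and every other
  contribution to \<open>p * q\<close> has smaller degree.
\<close>

lemma mpoly_degree_mult: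
  fixes p q :: "('v::linorder, 'k::field) mpoly"
  assumes "p \<noteq> 0" "q \<noteq> 0"
  shows "mpoly_degree (p * q) = mpoly_degree p + mpoly_degree q"
proof -
  define top where "top p = (\<Sum>m\<in>{m\<in>keys p. mdeg m = mpoly_degree p}. Poly_Mapping.single m (lookup p m))"
    for p :: "('v, 'k) mpoly"
  have lookup_top: "lookup (top p) m = (if mdeg m = mpoly_degree p then lookup p m else 0)"
    for p :: "('v, 'k) mpoly" and m
    by (auto simp: top_def lookup_sum lookup_single when_def in_keys_iff)
  have nz: "top p \<noteq> 0" if p: "p \<noteq> 0" for p
  proof -
    obtain m where "m \<in> keys p" "mdeg m = mpoly_degree p" using mpoly_degree_attained[OF p] .
    then have "lookup (top p) m \<noteq> 0" by (simp add: lookup_top in_keys_iff)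
    then show ?thesis by auto
  qed
  have low: "mdeg m < mpoly_degree p" if "m \<in> keys (p - top p)" for p m
    using that mdeg_le_mpoly_degree[of m p]
    by (auto simp: in_keys_iff lookup_minus lookup_top split: if_splits)
  have key_top: "m \<in> keys p \<and> mdeg m = mpoly_degree p" if "m \<in> keys (top p)" for p m
    using that by (auto simp: in_keys_iff lookup_top split: if_splits)
  have "top p * top q \<noteq> 0" using nz assms by simp
  then have "keys (top p * top q) \<noteq> {}" by simp
  then obtain m where m: "m \<in> keys (top p * top q)" by blast
  have dm: "mdeg m = mpoly_degree p + mpoly_degree q"
  proof -
    obtain x y where "m = x + y" "x \<in> keys (top p)" "y \<in> keys (top q)"
      using m keys_mult[of "top p" "top q"] by blast
    then show ?thesis using key_top[of x p] key_top[of y q] by (simp add: mdeg_add)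
  qed
  have "p * q = top p * top q + (top p * (q - top q) + (p - top p) * q)"
    by (simp add: algebra_simps)
  moreover have "m \<notin> keys (top p * (q - top q))"
  proof
    assume "m \<in> keys (top p * (q - top q))"
    then obtain x y where "m = x + y" "x \<in> keys (top p)" "y \<in> keys (q - top q)"
      using keys_mult[of "top p" "q - top q"] by blast
    then show False using low[of y q] key_top[of x p] dm by (simp add: mdeg_add)
  qed
  moreover have "m \<notin> keys ((p - top p) * q)"
  proof
    assume "m \<in> keys ((p - top p) * q)"
    then obtain x y where "m = x + y" "x \<in> keys (p - top p)" "y \<in> keys q"
      using keys_mult[of "p - top p" q] by blast
    then show False using low[of x p] mdeg_le_mpoly_degree[of y q] dm by (simp add: mdeg_add)
  qed
  ultimately have "m \<in> keys (p * q)" using m by (simp add: in_keys_iff lookup_add)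
  then have "mpoly_degree p + mpoly_degree q \<le> mpoly_degree (p * q)"
    using mdeg_le_mpoly_degree[of m] dm by simp
  then show ?thesis using mpoly_degree_mult_le[of p q] by simp
qed

lemma mpoly_degree_0_imp_unit:
  fixes c :: "('v::linorder, 'k::field) mpoly"
  assumes "c \<noteq> 0" "mpoly_degree c = 0"
  shows "c dvd 1"
proof -
  have "keys c \<subseteq> {0}"
    using mdeg_le_mpoly_degree[of _ c] assms(2) by (auto simp: mdeg_eq_0_iff)
  then have c: "c = mpoly_const (lookup c 0)"
    by (intro poly_mapping_eqI)
       (auto simp: mpoly_const_def lookup_single when_def in_keys_iff subset_iff)
  with assms have "lookup c 0 \<noteq> 0" by auto
  then have "1 = c * mpoly_const (inverse (lookup c 0))"
    by (subst c) (simp flip: mpoly_const_mult)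
  then show ?thesis by (metis dvd_triv_left)
qed

text \<open>
  Cancelling a common factor that is not a unit strictly decreases the sum of the degrees, because
  the degree is additive and polynomials of degree 0 are units. So a cancellation process stops at a
  coprime representation.
\<close>

lemma coprime_fraction_of_minimal_degree:
  fixes f :: "('v::linorder, 'k::field) ratfun"
  assumes "q \<noteq> 0" "f = Fract p q"
  shows "\<exists>p' q'. q' \<noteq> 0 \<and> mpoly_coprime p' q' \<and> f = Fract p' q' \<and>
           mpoly_degree p' + mpoly_degree q' \<le> mpoly_degree p + mpoly_degree q"
  using assms
proof (induction "mpoly_degree p + mpoly_degree q" arbitrary: p q rule: less_induct)
  case less
  show ?case
  proof (cases "mpoly_coprime p q")
    case True
    then show ?thesis using less.prems by blast
  next
    case False
    then obtain c p' q' where c: "p = c * p'" "q = c * q'" "\<not> c dvd 1"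
      unfolding mpoly_coprime_def dvd_def by metis
    have nz: "c \<noteq> 0" "q' \<noteq> 0" using c less.prems by auto
    have deg_c: "mpoly_degree c > 0" using mpoly_degree_0_imp_unit[OF nz(1)] c by blast
    have "mpoly_degree q = mpoly_degree c + mpoly_degree q'"
      unfolding c by (rule mpoly_degree_mult) fact+
    moreover have "mpoly_degree p' \<le> mpoly_degree p"
      by (cases "p' = 0") (simp_all add: c mpoly_degree_mult nz)
    ultimately have less_deg: "mpoly_degree p' + mpoly_degree q' < mpoly_degree p + mpoly_degree q"
      using deg_c by simp
    have "f = Fract p' q'" using less.prems nz by (simp add: c eq_fract)
    with less.hyps[OF less_deg nz(2)] less_deg show ?thesis by (meson less_imp_le order_trans)
  qed
qed

text \<open>
  Together with the next lemma this characterizes the degree of a rational function as the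
  smallest sum of degrees over all its representations, coprime or not.
\<close>

lemma ratfun_degree_le:
  fixes f :: "('v::linorder, 'k::field) ratfun"
  assumes "q \<noteq> 0" "f = Fract p q"
  shows "ratfun_degree f \<le> mpoly_degree p + mpoly_degree q"
proof -
  obtain p' q' where *: "q' \<noteq> 0" "mpoly_coprime p' q'" "f = Fract p' q'"
    "mpoly_degree p' + mpoly_degree q' \<le> mpoly_degree p + mpoly_degree q"
    using coprime_fraction_of_minimal_degree[OF assms] by blast
  then have "ratfun_degree f \<le> mpoly_degree p' + mpoly_degree q'"
    unfolding ratfun_degree_def by (intro Least_le) blast
  with * show ?thesis by simp
qed

lemma ratfun_degree_attained:
  fixes f :: "('v::linorder, 'k::field) ratfun"
  obtains p q where "q \<noteq> 0" "f = Fract p q" "ratfun_degree f = mpoly_degree p + mpoly_degree q"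
proof -
  obtain p q where "f = Fract p q" "q \<noteq> 0" by (cases f rule: Fract_cases_nonzero) (auto simp: Zero_fract_def)
  from coprime_fraction_of_minimal_degree[OF this(2,1)]
  have "\<exists>d p q. q \<noteq> 0 \<and> mpoly_coprime p q \<and> f = Fract p q \<and> d = mpoly_degree p + mpoly_degree q"
    by blast
  from LeastI_ex[OF this] show thesis
    unfolding ratfun_degree_def[symmetric] using that by blast
qed

section \<open>Adjoining elements to the constants\<close>

lemma ring_of_type_algebra_simps [simp]:
  "carrier (ring_of_type_algebra :: 'a::field ring) = UNIV"
  "x \<otimes>\<^bsub>ring_of_type_algebra\<^esub> y = x * (y :: 'a)"
  "x \<oplus>\<^bsub>ring_of_type_algebra\<^esub> y = x + (y :: 'a)"
  "\<one>\<^bsub>ring_of_type_algebra\<^esub> = (1 :: 'a)"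
  "\<zero>\<^bsub>ring_of_type_algebra\<^esub> = (0 :: 'a)"
  by (simp_all add: ring_of_type_algebra_def)

lemma ring_of_type_algebra_a_inv [simp]: "\<ominus>\<^bsub>ring_of_type_algebra\<^esub> x = - (x :: 'a::field)"
proof -
  interpret R: Ring.field "ring_of_type_algebra :: 'a ring" by (rule field_from_type_algebra)
  show ?thesis by (rule R.minus_equality) auto
qed

lemma ring_of_type_algebra_m_inv [simp]:
  "x \<noteq> 0 \<Longrightarrow> inv\<^bsub>ring_of_type_algebra\<^esub> x = inverse (x :: 'a::field)"
proof -
  interpret R: Ring.field "ring_of_type_algebra :: 'a ring" by (rule field_from_type_algebra)
  show "x \<noteq> 0 \<Longrightarrow> ?thesis" by (rule R.comm_inv_char) auto
qed

lemma ratfun_const_conv: "ratfun_const c = to_fract (mpoly_const c)"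
  by (simp add: ratfun_const_def to_fract_def)

lemma ratfun_const_0 [simp]: "ratfun_const 0 = 0"
  and ratfun_const_1 [simp]: "ratfun_const 1 = 1"
  by (simp_all add: ratfun_const_conv)

lemma ratfun_const_eq_0_iff [simp]: "ratfun_const c = 0 \<longleftrightarrow> c = 0"
  by (simp add: ratfun_const_conv)

context
  fixes A :: "('v::linorder, 'k::field) ratfun set"
begin

lemma adjoin_incl: "x \<in> A \<Longrightarrow> x \<in> adjoin A"
  and adjoin_const: "ratfun_const c \<in> adjoin A"
  and adjoin_add: "x \<in> adjoin A \<Longrightarrow> y \<in> adjoin A \<Longrightarrow> x + y \<in> adjoin A"
  and adjoin_mult: "x \<in> adjoin A \<Longrightarrow> y \<in> adjoin A \<Longrightarrow> x * y \<in> adjoin A"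
  and adjoin_uminus: "x \<in> adjoin A \<Longrightarrow> - x \<in> adjoin A"
  unfolding adjoin_def
  by (auto intro: generate_field.incl
      dest: generate_field.eng_add[of x ring_of_type_algebra _ y]
        generate_field.eng_mult[of x ring_of_type_algebra _ y]
        generate_field.a_inv[of x ring_of_type_algebra])

lemma adjoin_inverse: "x \<in> adjoin A \<Longrightarrow> inverse x \<in> adjoin A"
  by (cases "x = 0") (auto simp: adjoin_def dest: generate_field.m_inv[of x ring_of_type_algebra])

lemma adjoin_divide: "x \<in> adjoin A \<Longrightarrow> y \<in> adjoin A \<Longrightarrow> x / y \<in> adjoin A"
  by (simp add: divide_inverse adjoin_mult adjoin_inverse)

lemma adjoin_0: "0 \<in> adjoin A" and adjoin_1: "1 \<in> adjoin A"
  using adjoin_const[of 0] adjoin_const[of 1] by simp_all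

lemma adjoin_sum: "(\<And>i. i \<in> I \<Longrightarrow> f i \<in> adjoin A) \<Longrightarrow> sum f I \<in> adjoin A"
  by (induction I rule: infinite_finite_induct) (auto simp: adjoin_0 adjoin_add)

lemma adjoin_prod: "(\<And>i. i \<in> I \<Longrightarrow> f i \<in> adjoin A) \<Longrightarrow> prod f I \<in> adjoin A"
  by (induction I rule: infinite_finite_induct) (auto simp: adjoin_1 adjoin_mult)

lemma adjoin_power: "x \<in> adjoin A \<Longrightarrow> x ^ k \<in> adjoin A"
  by (induction k) (auto simp: adjoin_1 adjoin_mult)

lemma adjoin_power_int: "x \<in> adjoin A \<Longrightarrow> x powi k \<in> adjoin A"
  by (simp add: power_int_def adjoin_power adjoin_inverse)

text \<open>
  The induction principle for \<open>adjoin\<close> in terms of the operations of the type, instead of those of the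
  ring structure \<open>ring_of_type_algebra\<close>.
\<close>

lemma adjoin_least:
  assumes "A \<subseteq> K" "\<And>c. ratfun_const c \<in> K"
    and "\<And>x y. x \<in> K \<Longrightarrow> y \<in> K \<Longrightarrow> x + y \<in> K" "\<And>x y. x \<in> K \<Longrightarrow> y \<in> K \<Longrightarrow> x * y \<in> K"
    and "\<And>x. x \<in> K \<Longrightarrow> - x \<in> K" "\<And>x. x \<in> K \<Longrightarrow> inverse x \<in> K"
  shows "adjoin A \<subseteq> K"
proof
  fix x assume "x \<in> adjoin A"
  then show "x \<in> K"
    unfolding adjoin_def
  proof (induction rule: generate_field.induct)
    case one
    then show ?case using assms(2)[of 1] by simp
  qed (use assms in auto)
qed

end

lemma adjoin_mono: "A \<subseteq> B \<Longrightarrow> adjoin A \<subseteq> adjoin B"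
  by (rule adjoin_least)
     (blast intro: adjoin_incl adjoin_const adjoin_add adjoin_mult adjoin_uminus adjoin_inverse)+

lemma algebraic_adjoin_self:
  assumes "x \<in> adjoin A"
  shows "ring.algebraic ring_of_type_algebra (adjoin A) x"
proof -
  interpret R: Ring.field "ring_of_type_algebra :: ('a, 'b) ratfun ring" by (rule field_from_type_algebra)
  have "subfield (adjoin A) ring_of_type_algebra"
    unfolding adjoin_def by (rule R.generate_field_is_subfield) simp
  from R.algebraic_self[OF subfieldE(1)[OF this] assms] show ?thesis
    by (simp add: over_def)
qed

lemma ring_of_type_algebra_eval_Cons:
  "ring.eval ring_of_type_algebra (c # cs) x =
     c * x ^ length cs + ring.eval ring_of_type_algebra cs (x :: 'a::field)"
proof -
  interpret R: Ring.field "ring_of_type_algebra :: 'a ring" by (rule field_from_type_algebra)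
  have "x [^]\<^bsub>ring_of_type_algebra\<^esub> k = x ^ k" for k :: nat
    by (induction k) auto
  then show ?thesis by simp
qed

section \<open>Weights of monomials\<close>

definition wt :: "('v::finite \<Rightarrow> int) \<Rightarrow> ('v \<Rightarrow>\<^sub>0 nat) \<Rightarrow> int" where
  "wt \<omega> m = (\<Sum>i\<in>UNIV. \<omega> i * int (lookup m i))"

lemma wt_0 [simp]: "wt \<omega> 0 = 0"
  by (simp add: wt_def)

lemma wt_add: "wt \<omega> (m + m') = wt \<omega> m + wt \<omega> m'"
  by (simp add: wt_def lookup_add algebra_simps sum.distrib)

text \<open>
  Weights are compared modulo \<open>N\<close>: the case \<open>N = n\<close> describes the action of the group, and \<open>N = 0\<close>
  gives an honest integral grading.
\<close>

definition graded :: "('v::finite \<Rightarrow> int) \<Rightarrow> int \<Rightarrow> int \<Rightarrow> ('v, 'k::zero) mpoly \<Rightarrow> bool" where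
  "graded \<omega> N c p \<longleftrightarrow> (\<forall>m\<in>keys p. N dvd wt \<omega> m - c)"

lemma graded_const: "graded \<omega> N 0 (mpoly_const c)"
  by (simp add: graded_def mpoly_const_def)

lemma graded_add: "graded \<omega> N c p \<Longrightarrow> graded \<omega> N c q \<Longrightarrow> graded \<omega> N c (p + q)"
  using keys_add[of p q] by (auto simp: graded_def)

lemma graded_uminus: "graded \<omega> N c p \<Longrightarrow> graded \<omega> N c (- p :: ('v::finite, 'k::ab_group_add) mpoly)"
  by (simp add: graded_def in_keys_iff)

lemma graded_mult:
  assumes "graded \<omega> N c p" "graded \<omega> N d q"
  shows "graded \<omega> N (c + d) (p * q :: ('v::finite, 'k::comm_ring_1) mpoly)"
  unfolding graded_def
proof
  fix m assume "m \<in> keys (p * q)"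
  then obtain x y where m: "m = x + y" and "x \<in> keys p" "y \<in> keys q"
    using keys_mult[of p q] by blast
  with assms have "N dvd (wt \<omega> x - c) + (wt \<omega> y - d)" by (auto simp: graded_def)
  then show "N dvd wt \<omega> m - (c + d)" by (simp add: m wt_add algebra_simps)
qed

lemma graded_power:
  "graded \<omega> N c p \<Longrightarrow> graded \<omega> N (int k * c) (p ^ k :: ('v::finite, 'k::comm_ring_1) mpoly)"
proof (induction k)
  case 0
  then show ?case using graded_const[of \<omega> N "1::'k"] by simp
next
  case (Suc k)
  then show ?case using graded_mult[of \<omega> N c p "int k * c" "p ^ k"] by (simp add: algebra_simps)
qed

definition mono_of :: "('v::finite \<Rightarrow> nat) \<Rightarrow> ('v \<Rightarrow>\<^sub>0 nat)" where
  "mono_of e = Abs_poly_mapping e"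

lemma lookup_mono_of [simp]: "lookup (mono_of e) = e"
  by (simp add: mono_of_def)

section \<open>Laurent monomials in a system of linear coordinates\<close>

text \<open>
  A linear change of variables and its inverse, both given as substitutions. The statements about
  rational functions below are all made in the coordinates \<open>y i\<close>, while polynomials are written in
  the original variables and transported by \<open>\<Phi>\<close>; in this way the exponents of a polynomial remain visible
  to \<open>keys\<close>.
\<close>

locale linear_coordinates =
  fixes y z :: "'v::{finite,linorder} \<Rightarrow> ('v, 'k::field) mpoly"
  assumes psubst_y_z [simp]: "psubst y (z i) = mpoly_var i"
    and psubst_z_y [simp]: "psubst z (y i) = mpoly_var i"
    and degree_y: "mpoly_degree (y i) \<le> 1"
    and degree_z: "mpoly_degree (z i) \<le> 1"
begin

abbreviation \<Phi> :: "('v, 'k) mpoly \<Rightarrow> ('v, 'k) mpoly" where "\<Phi> \<equiv> psubst y"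

lemma psubst_z_\<Phi> [simp]: "psubst z (\<Phi> p) = p"
  by (simp add: psubst_psubst)

lemma \<Phi>_psubst_z [simp]: "\<Phi> (psubst z p) = p"
  by (simp add: psubst_psubst)

lemma \<Phi>_eq_iff [simp]: "\<Phi> p = \<Phi> q \<longleftrightarrow> p = q"
  by (metis psubst_z_\<Phi>)

lemma \<Phi>_eq_0_iff [simp]: "\<Phi> p = 0 \<longleftrightarrow> p = 0"
  using \<Phi>_eq_iff[of p 0] by (simp del: \<Phi>_eq_iff)

lemma degree_\<Phi> [simp]: "mpoly_degree (\<Phi> p) = mpoly_degree p"
proof (rule antisym)
  show "mpoly_degree (\<Phi> p) \<le> mpoly_degree p"
    by (rule mpoly_degree_psubst_le) (rule degree_y)
  show "mpoly_degree p \<le> mpoly_degree (\<Phi> p)"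
    using mpoly_degree_psubst_le[of z "\<Phi> p"] degree_z by simp
qed

lemma ratfun_degree_attained_\<Phi>:
  obtains p q where "q \<noteq> 0" "f = to_fract (\<Phi> p) / to_fract (\<Phi> q)"
    "ratfun_degree f = mpoly_degree p + mpoly_degree q"
proof -
  obtain p q where "q \<noteq> 0" "f = Fract p q" "ratfun_degree f = mpoly_degree p + mpoly_degree q"
    using ratfun_degree_attained .
  then have "psubst z q \<noteq> 0" "f = to_fract (\<Phi> (psubst z p)) / to_fract (\<Phi> (psubst z q))"
    "ratfun_degree f = mpoly_degree (psubst z p) + mpoly_degree (psubst z q)"
    using \<Phi>_eq_0_iff[of "psubst z q"] degree_\<Phi>[of "psubst z p"] degree_\<Phi>[of "psubst z q"]
    by (simp_all add: Fract_conv_to_fract del: \<Phi>_eq_0_iff degree_\<Phi>)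
  then show thesis using that by blast
qed

definition laurent :: "('v \<Rightarrow> int) \<Rightarrow> ('v, 'k) ratfun" where
  "laurent e = (\<Prod>i\<in>UNIV. to_fract (y i) powi e i)"

lemma y_nonzero: "y i \<noteq> 0"
proof
  assume "y i = 0"
  then have "(mpoly_var i :: ('v, 'k) mpoly) = 0" using psubst_z_y[of i] by simp
  then show False unfolding mpoly_var_def by (metis lookup_single_eq lookup_zero zero_neq_one)
qed

lemma laurent_nonzero: "laurent e \<noteq> 0"
  by (simp add: laurent_def y_nonzero)

lemma laurent_add: "laurent (\<lambda>i. e i + f i) = laurent e * laurent f"
  by (simp add: laurent_def power_int_add y_nonzero prod.distrib)

lemma laurent_0 [simp]: "laurent (\<lambda>i. 0) = 1"
  by (simp add: laurent_def)

lemma laurent_diff: "laurent (\<lambda>i. e i - f i) = laurent e / laurent f"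
  by (simp add: laurent_def power_int_diff y_nonzero prod_dividef)

lemma laurent_scale: "laurent (\<lambda>i. c * e i) = laurent e powi c"
proof -
  have "(\<Prod>i\<in>I. f i) powi c = (\<Prod>i\<in>I. f i powi c)" for f :: "'v \<Rightarrow> ('v, 'k) ratfun" and I
    by (induction I rule: infinite_finite_induct) (simp_all add: power_int_mult_distrib)
  then show ?thesis by (simp add: laurent_def power_int_mult mult.commute[of c])
qed

lemma laurent_sum: "laurent (\<lambda>i. \<Sum>x\<in>I. f x i) = (\<Prod>x\<in>I. laurent (f x))"
  by (induction I rule: infinite_finite_induct) (simp_all add: laurent_add)

lemma to_fract_\<Phi>_single:
  "to_fract (\<Phi> (Poly_Mapping.single m c)) = ratfun_const c * laurent (\<lambda>i. int (lookup m i))"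
proof -
  have pow: "to_fract (p ^ k) = to_fract p ^ k" for p :: "('v, 'k) mpoly" and k
    by (induction k) simp_all
  have "to_fract (\<Prod>i\<in>A. f i) = (\<Prod>i\<in>A. to_fract (f i))" for f :: "'v \<Rightarrow> ('v, 'k) mpoly" and A
    by (induction A rule: infinite_finite_induct) simp_all
  then show ?thesis
    by (simp add: psubst_single mon_eval_UNIV laurent_def ratfun_const_conv pow)
qed

lemma to_fract_sum: "to_fract (sum f A) = (\<Sum>x\<in>A. to_fract (f x))"
  for f :: "'a \<Rightarrow> ('v, 'k) mpoly"
  by (induction A rule: infinite_finite_induct) simp_all

lemma to_fract_\<Phi>:
  "to_fract (\<Phi> p) = (\<Sum>m\<in>keys p. ratfun_const (lookup p m) * laurent (\<lambda>i. int (lookup m i)))"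
  by (subst sum_single_lookup[of p, symmetric])
     (simp add: psubst_sum to_fract_sum to_fract_\<Phi>_single)

lemma laurent_conv_fraction:
  "laurent e = to_fract (\<Phi> (Poly_Mapping.single (mono_of (\<lambda>i. nat (e i))) 1)) /
     to_fract (\<Phi> (Poly_Mapping.single (mono_of (\<lambda>i. nat (- e i))) 1))"
proof -
  have "laurent e = laurent (\<lambda>i. int (nat (e i)) - int (nat (- e i)))"
    by (rule arg_cong[of _ _ laurent]) auto
  then show ?thesis by (simp add: laurent_diff to_fract_\<Phi>_single)
qed

lemma ratfun_degree_laurent_le: "ratfun_degree (laurent e) \<le> nat (\<Sum>i\<in>UNIV. \<bar>e i\<bar>)"
proof -
  let ?p = "Poly_Mapping.single (mono_of (\<lambda>i. nat (e i))) (1::'k)"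
    and ?q = "Poly_Mapping.single (mono_of (\<lambda>i. nat (- e i))) (1::'k)"
  have deg: "mpoly_degree (Poly_Mapping.single m (1::'k)) \<le> mdeg m" for m :: "'v \<Rightarrow>\<^sub>0 nat"
    by (simp add: mpoly_degree_le_iff)
  have "?q \<noteq> 0" by (metis lookup_single_eq lookup_zero zero_neq_one)
  then have "ratfun_degree (laurent e) \<le> mpoly_degree (\<Phi> ?p) + mpoly_degree (\<Phi> ?q)"
    by (intro ratfun_degree_le) (simp_all only: laurent_conv_fraction[of e] Fract_conv_to_fract \<Phi>_eq_0_iff not_False_eq_True)
  also have "\<dots> \<le> mdeg (mono_of (\<lambda>i. nat (e i))) + mdeg (mono_of (\<lambda>i. nat (- e i)))"
    unfolding degree_\<Phi> by (intro add_mono deg)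
  also have "\<dots> = nat (\<Sum>i\<in>UNIV. \<bar>e i\<bar>)"
    unfolding mdeg_UNIV lookup_mono_of sum.distrib[symmetric]
    by (intro int_int_eq[THEN iffD1]) (auto simp: sum_nonneg intro!: sum.cong)
  finally show ?thesis .
qed

text \<open>
  After multiplication with a high power of the product of all coordinates the Laurent monomials
  become distinct ordinary monomials.
\<close>

lemma laurent_independent:
  assumes "finite I" "inj_on E I" "(\<Sum>x\<in>I. ratfun_const (c x) * laurent (E x)) = 0" "x \<in> I"
  shows "c x = 0"
proof -
  \<comment> \<open>Any \<open>N\<close> that makes all exponents \<open>E x i + N\<close> nonnegative would do.\<close>
  define N where "N = (\<Sum>x\<in>I. \<Sum>i\<in>UNIV. \<bar>E x i\<bar>)"
  have N: "E x i + N \<ge> 0" if "x \<in> I" for x i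
  proof -
    have "\<bar>E x i\<bar> \<le> (\<Sum>i\<in>UNIV. \<bar>E x i\<bar>)" by (rule member_le_sum) auto
    also have "\<dots> \<le> N" unfolding N_def using that assms(1) by (intro member_le_sum) (auto intro: sum_nonneg)
    finally show ?thesis by simp
  qed
  define M where "M x = mono_of (\<lambda>i. nat (E x i + N))" for x
  have inj: "inj_on M I"
  proof (rule inj_onI)
    fix a b assume ab: "a \<in> I" "b \<in> I" "M a = M b"
    then have "lookup (M a) i = lookup (M b) i" for i by simp
    then have "E a i = E b i" for i
      using N[OF ab(1), of i] N[OF ab(2), of i] by (simp add: M_def) (metis add_right_cancel eq_nat_nat_iff)
    then show "a = b" using assms(2) ab by (metis ext inj_onD)
  qed
  have "to_fract (\<Phi> (\<Sum>x\<in>I. Poly_Mapping.single (M x) (c x))) =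
      (\<Sum>x\<in>I. ratfun_const (c x) * laurent (\<lambda>i. E x i + N))"
    unfolding psubst_sum to_fract_sum
    by (intro sum.cong refl) (simp add: to_fract_\<Phi>_single M_def N)
  also have "\<dots> = (\<Sum>x\<in>I. ratfun_const (c x) * laurent (E x)) * laurent (\<lambda>i. N)"
    by (simp add: laurent_add sum_distrib_right mult.assoc)
  finally have "(\<Sum>x\<in>I. Poly_Mapping.single (M x) (c x)) = 0"
    using assms(3) by simp
  then have "0 = lookup (\<Sum>x\<in>I. Poly_Mapping.single (M x) (c x)) (M x)" by simp
  also have "\<dots> = (\<Sum>a\<in>I. if a = x then c a else 0)"
    unfolding lookup_sum using inj assms(4)
    by (intro sum.cong refl) (auto simp: lookup_single when_def dest: inj_onD)
  also have "\<dots> = c x" using assms by simp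
  finally show ?thesis by simp
qed

lemma laurent_eq_iff: "laurent e = laurent f \<longleftrightarrow> e = f"
proof
  assume *: "laurent e = laurent f"
  show "e = f"
  proof (rule ccontr)
    assume "e \<noteq> f"
    let ?E = "\<lambda>b. if b then e else f" and ?c = "\<lambda>b. if b then 1 else - 1 :: 'k"
    have inj: "inj_on ?E {True, False}" using \<open>e \<noteq> f\<close> by (auto simp: inj_on_def)
    have "ratfun_const (- 1 :: 'k) = (- 1 :: ('v, 'k) ratfun)"
      by (simp add: ratfun_const_conv mpoly_const_def single_uminus)
    then have "(\<Sum>b\<in>{True, False}. ratfun_const (?c b) * laurent (?E b)) = 0" using * by simp
    from laurent_independent[OF _ inj this, of True] show False by simp
  qed
qed simp

text \<open>
  A monomial in the Laurent monomials \<open>laurent (u i)\<close> is again a Laurent monomial, and linear independence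
  of the exponent vectors makes distinct monomials go to distinct exponents. An algebraic relation
  is then a linear relation between distinct Laurent monomials.
\<close>

lemma algebraically_independent_laurent:
  fixes u :: "'v \<Rightarrow> 'v \<Rightarrow> int"
  assumes indep: "\<And>c. (\<And>j. (\<Sum>i\<in>UNIV. c i * u i j) = 0) \<Longrightarrow> c = (\<lambda>i. 0)"
  shows "algebraically_independent (range (\<lambda>i. laurent (u i)))"
proof -
  define t where "t i = laurent (u i)" for i
  have "inj t"
  proof (rule injI, rule ccontr)
    fix a b assume "t a = t b" "a \<noteq> b"
    then have "u a = u b" by (simp add: t_def laurent_eq_iff)
    have "(\<lambda>i. if i = a then 1 else if i = b then - 1 else 0) = (\<lambda>i. 0 :: int)"
    proof (rule indep)
      fix j
      have "(\<Sum>i\<in>UNIV. (if i = a then 1 else if i = b then - 1 else 0) * u i j) =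
          (\<Sum>i\<in>{a, b}. (if i = a then 1 else if i = b then - 1 else 0) * u i j)"
        by (rule sum.mono_neutral_right) auto
      also have "\<dots> = 0" using \<open>a \<noteq> b\<close> \<open>u a = u b\<close> by simp
      finally show "(\<Sum>i\<in>UNIV. (if i = a then 1 else if i = b then - 1 else 0) * u i j) = 0" .
    qed
    from fun_cong[OF this, of a] show False by simp
  qed
  show ?thesis
    unfolding algebraically_independent_def t_def[symmetric]
  proof (intro allI impI)
    fix P :: "(('v, 'k) ratfun, 'k) mpoly"
    assume keys: "\<forall>m\<in>keys P. keys m \<subseteq> range t" and eval: "mpoly_eval ratfun_const id P = 0"
    define E where "E m = (\<lambda>j. \<Sum>i\<in>UNIV. int (lookup m (t i)) * u i j)" for m
    have mon: "(\<Prod>f\<in>keys m. id f ^ lookup m f) = laurent (E m)" if "m \<in> keys P" for m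
    proof -
      have "(\<Prod>f\<in>keys m. id f ^ lookup m f) = (\<Prod>f\<in>range t. f ^ lookup m f)"
        using keys that by (intro prod.mono_neutral_cong_left) (auto simp: in_keys_iff)
      also have "\<dots> = (\<Prod>i\<in>UNIV. t i ^ lookup m (t i))"
        using \<open>inj t\<close> by (simp add: prod.reindex)
      also have "\<dots> = (\<Prod>i\<in>UNIV. laurent (\<lambda>j. int (lookup m (t i)) * u i j))"
        by (simp add: laurent_scale t_def)
      finally show ?thesis by (simp add: laurent_sum E_def)
    qed
    have inj: "inj_on E (keys P)"
    proof (rule inj_onI)
      fix m m' assume m: "m \<in> keys P" "m' \<in> keys P" "E m = E m'"
      have "(\<lambda>i. int (lookup m (t i)) - int (lookup m' (t i))) = (\<lambda>i. 0)"
      proof (rule indep)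
        fix j
        show "(\<Sum>i\<in>UNIV. (int (lookup m (t i)) - int (lookup m' (t i))) * u i j) = 0"
          using fun_cong[OF m(3), of j] by (simp add: E_def left_diff_distrib sum_subtractf)
      qed
      from fun_cong[OF this] have "lookup m (t i) = lookup m' (t i)" for i by simp
      moreover have "lookup m f = 0 \<and> lookup m' f = 0" if "f \<notin> range t" for f
        using that bspec[OF keys m(1)] bspec[OF keys m(2)] by (auto simp: in_keys_iff)
      ultimately have "lookup m f = lookup m' f" for f
        by (cases "f \<in> range t") auto
      then show "m = m'" by (rule poly_mapping_eqI)
    qed
    have "(\<Sum>m\<in>keys P. ratfun_const (lookup P m) * laurent (E m)) = 0"
      using eval mon by (simp add: mpoly_eval_def)
    from laurent_independent[OF _ inj this] have "lookup P m = 0" if "m \<in> keys P" for m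
      using that by simp
    then have "keys P = {}" by (metis in_keys_iff equals0I)
    then show "P = 0" by simp
  qed
qed

section \<open>Fields of fractions of equal weight\<close>

text \<open>
  Rational functions that are homogeneous of weight 0, with weights counted modulo \<open>N\<close>. For \<open>N = 0\<close> these are
  the rational invariants of a one-dimensional diagonal torus, and for \<open>N = n\<close> those of a diagonal
  action of a cyclic group of order \<open>n\<close>.
\<close>

definition wfield :: "('v \<Rightarrow> int) \<Rightarrow> int \<Rightarrow> ('v, 'k) ratfun set" where
  "wfield \<omega> N = {to_fract (\<Phi> p) / to_fract (\<Phi> q) |p q c. q \<noteq> 0 \<and> graded \<omega> N c p \<and> graded \<omega> N c q}"

lemma wfieldI:
  "q \<noteq> 0 \<Longrightarrow> graded \<omega> N c p \<Longrightarrow> graded \<omega> N c q \<Longrightarrow> f = to_fract (\<Phi> p) / to_fract (\<Phi> q) \<Longrightarrow> f \<in> wfield \<omega> N"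
  unfolding wfield_def by blast

lemma wfieldE:
  assumes "f \<in> wfield \<omega> N"
  obtains p q c where "q \<noteq> 0" "graded \<omega> N c p" "graded \<omega> N c q" "f = to_fract (\<Phi> p) / to_fract (\<Phi> q)"
  using assms unfolding wfield_def by blast

lemma wfield_const: "ratfun_const c \<in> wfield \<omega> N"
  by (rule wfieldI[of 1 _ _ 0 "mpoly_const c"])
     (use graded_const[of \<omega> N "1::'k"] in \<open>simp_all add: graded_const ratfun_const_conv\<close>)

lemma wfield_add:
  assumes "f \<in> wfield \<omega> N" "g \<in> wfield \<omega> N"
  shows "f + g \<in> wfield \<omega> N"
proof -
  obtain p q c where f: "q \<noteq> 0" "graded \<omega> N c p" "graded \<omega> N c q" "f = to_fract (\<Phi> p) / to_fract (\<Phi> q)"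
    using wfieldE[OF assms(1)] .
  obtain r s d where g: "s \<noteq> 0" "graded \<omega> N d r" "graded \<omega> N d s" "g = to_fract (\<Phi> r) / to_fract (\<Phi> s)"
    using wfieldE[OF assms(2)] .
  show ?thesis
  proof (rule wfieldI[of "q * s" \<omega> N "c + d" "p * s + q * r"])
    show "f + g = to_fract (\<Phi> (p * s + q * r)) / to_fract (\<Phi> (q * s))"
      using f(1) g(1) by (simp add: f g psubst_add psubst_mult field_simps)
  qed (use f g in \<open>auto intro!: graded_add graded_mult\<close>)
qed

lemma wfield_mult:
  assumes "f \<in> wfield \<omega> N" "g \<in> wfield \<omega> N"
  shows "f * g \<in> wfield \<omega> N"
proof -
  obtain p q c where f: "q \<noteq> 0" "graded \<omega> N c p" "graded \<omega> N c q" "f = to_fract (\<Phi> p) / to_fract (\<Phi> q)"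
    using wfieldE[OF assms(1)] .
  obtain r s d where g: "s \<noteq> 0" "graded \<omega> N d r" "graded \<omega> N d s" "g = to_fract (\<Phi> r) / to_fract (\<Phi> s)"
    using wfieldE[OF assms(2)] .
  show ?thesis
    by (rule wfieldI[of "q * s" \<omega> N "c + d" "p * r"])
       (use f g in \<open>auto intro!: graded_mult simp: psubst_mult\<close>)
qed

lemma wfield_uminus:
  assumes "f \<in> wfield \<omega> N"
  shows "- f \<in> wfield \<omega> N"
proof -
  obtain p q c where f: "q \<noteq> 0" "graded \<omega> N c p" "graded \<omega> N c q" "f = to_fract (\<Phi> p) / to_fract (\<Phi> q)"
    using wfieldE[OF assms] .
  show ?thesis
    by (rule wfieldI[of q _ _ c "- p"]) (use f in \<open>auto intro: graded_uminus simp: psubst_uminus\<close>)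
qed

lemma wfield_inverse:
  assumes "f \<in> wfield \<omega> N"
  shows "inverse f \<in> wfield \<omega> N"
proof -
  obtain p q c where f: "q \<noteq> 0" "graded \<omega> N c p" "graded \<omega> N c q" "f = to_fract (\<Phi> p) / to_fract (\<Phi> q)"
    using wfieldE[OF assms] .
  show ?thesis
  proof (cases "p = 0")
    case True
    then show ?thesis using f wfield_const[of 0] by simp
  next
    case False
    show ?thesis by (rule wfieldI[of p _ _ c q]) (use f False in auto)
  qed
qed

lemma adjoin_subset_wfield: "A \<subseteq> wfield \<omega> N \<Longrightarrow> adjoin A \<subseteq> wfield \<omega> N"
  by (rule adjoin_least) (auto intro: wfield_const wfield_add wfield_mult wfield_uminus wfield_inverse)

lemma graded_single: "graded \<omega> N (wt \<omega> m) (Poly_Mapping.single m c)"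
  by (simp add: graded_def)

lemma laurent_in_wfield:
  assumes "N dvd (\<Sum>i\<in>UNIV. \<omega> i * e i)"
  shows "laurent e \<in> wfield \<omega> N"
proof (rule wfieldI[OF _ _ _ laurent_conv_fraction])
  let ?m = "mono_of (\<lambda>i. nat (e i))" and ?m' = "mono_of (\<lambda>i. nat (- e i))"
  show "Poly_Mapping.single ?m' (1::'k) \<noteq> 0" by (metis lookup_single_eq lookup_zero zero_neq_one)
  show "graded \<omega> N (wt \<omega> ?m) (Poly_Mapping.single ?m (1::'k))" by (rule graded_single)
  have "wt \<omega> ?m - wt \<omega> ?m' = (\<Sum>i\<in>UNIV. \<omega> i * e i)"
    unfolding wt_def sum_subtractf[symmetric] by (intro sum.cong refl) (auto simp flip: right_diff_distrib)
  then have "N dvd wt \<omega> ?m' - wt \<omega> ?m" using assms by (metis dvd_minus_iff minus_diff_eq)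
  then show "graded \<omega> N (wt \<omega> ?m) (Poly_Mapping.single ?m' (1::'k))" by (simp add: graded_def)
qed

text \<open>
  Divide numerator and denominator by one monomial \<open>m0\<close> of the denominator: all remaining exponents are
  differences of exponents of equal weight.
\<close>

lemma wfield_subset_adjoin:
  assumes "\<And>e. N dvd (\<Sum>i\<in>UNIV. \<omega> i * e i) \<Longrightarrow> laurent e \<in> adjoin T"
  shows "wfield \<omega> N \<subseteq> adjoin T"
proof
  fix f assume "f \<in> wfield \<omega> N"
  then obtain p q c where f: "q \<noteq> 0" "graded \<omega> N c p" "graded \<omega> N c q" "f = to_fract (\<Phi> p) / to_fract (\<Phi> q)"
    by (rule wfieldE)
  from f(1) have "keys q \<noteq> {}" by simp
  then obtain m0 where m0: "m0 \<in> keys q" by blast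
  let ?L = "laurent (\<lambda>i. int (lookup m0 i))"
  have *: "to_fract (\<Phi> r) / ?L \<in> adjoin T" if r: "graded \<omega> N c r" for r
  proof -
    have "to_fract (\<Phi> r) / ?L =
        (\<Sum>m\<in>keys r. ratfun_const (lookup r m) * laurent (\<lambda>i. int (lookup m i) - int (lookup m0 i)))"
      by (simp add: to_fract_\<Phi> sum_divide_distrib laurent_diff)
    also have "\<dots> \<in> adjoin T"
    proof (intro adjoin_sum adjoin_mult adjoin_const assms)
      fix m assume "m \<in> keys r"
      then have "N dvd wt \<omega> m - c" "N dvd wt \<omega> m0 - c" using r f(3) m0 by (auto simp: graded_def)
      from dvd_diff[OF this] have "N dvd wt \<omega> m - wt \<omega> m0" by simp
      then show "N dvd (\<Sum>i\<in>UNIV. \<omega> i * (int (lookup m i) - int (lookup m0 i)))"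
        by (simp add: wt_def right_diff_distrib sum_subtractf)
    qed
    finally show ?thesis .
  qed
  have "f = (to_fract (\<Phi> p) / ?L) / (to_fract (\<Phi> q) / ?L)"
    using laurent_nonzero f(4) by simp
  then show "f \<in> adjoin T" using *[OF f(2)] *[OF f(3)] by (simp only: adjoin_divide)
qed

text \<open>
  In an equation \<open>c_l * x^l + ... + c_0 = 0\<close> over \<open>wfield \<omega> 0\<close> with \<open>x = to_fract (\<Phi> h)\<close> the summands
  have the distinct weights \<open>l * s, ..., 0\<close> and cannot cancel. The induction clears denominators
  one coefficient at a time: the common denominator has some weight \<open>w\<close>, and the numerator only has
  the weights \<open>w + k * s\<close> with \<open>k\<close> below the number of coefficients, the highest of them
  occurring whenever the leading coefficient is nonzero.
\<close>

lemma not_algebraic_over_wfield: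
  assumes h: "h \<noteq> 0" "graded \<omega> 0 s h" "s \<noteq> 0"
    and A: "A \<subseteq> wfield \<omega> 0"
  shows "\<not> ring.algebraic ring_of_type_algebra (adjoin A) (to_fract (\<Phi> h))"
proof
  let ?R = "ring_of_type_algebra :: ('v, 'k) ratfun ring"
  interpret R: Ring.field ?R by (rule field_from_type_algebra)
  let ?x = "to_fract (\<Phi> h)"
  have "\<exists>P Q w. Q \<noteq> 0 \<and> graded \<omega> 0 w Q \<and> R.eval cs ?x = to_fract (\<Phi> P) / to_fract (\<Phi> Q) \<and>
      (\<forall>m\<in>keys P. \<exists>k<length cs. wt \<omega> m = w + int k * s) \<and> (cs \<noteq> [] \<and> hd cs \<noteq> 0 \<longrightarrow> P \<noteq> 0)"
    if "set cs \<subseteq> wfield \<omega> 0" for cs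
    using that
  proof (induction cs)
    case Nil
    show ?case
      by (intro exI[of _ 0] exI[of _ 1]) (use graded_const[of \<omega> 0 "1::'k"] in auto)
  next
    case (Cons c cs)
    then obtain P Q w where PQ: "Q \<noteq> 0" "graded \<omega> 0 w Q" "R.eval cs ?x = to_fract (\<Phi> P) / to_fract (\<Phi> Q)"
      "\<And>m. m \<in> keys P \<Longrightarrow> \<exists>k<length cs. wt \<omega> m = w + int k * s"
      by (metis insert_subset list.simps(15))
    from Cons.prems obtain r t v where rt: "t \<noteq> 0" "graded \<omega> 0 v r" "graded \<omega> 0 v t" "c = to_fract (\<Phi> r) / to_fract (\<Phi> t)"
      by (auto elim: wfieldE)
    define l where "l = length cs"
    have pow: "to_fract (\<Phi> (h ^ k)) = ?x ^ k" for k
      by (induction k) (simp_all add: psubst_mult)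
    \<comment> \<open>The contribution of the new leading coefficient \<open>c\<close> to the numerator over the denominator \<open>t * Q\<close>.\<close>
    define P1 where "P1 = r * h ^ l * Q"
    have gr1: "wt \<omega> m = v + w + int l * s" if "m \<in> keys P1" for m
      using graded_mult[OF graded_mult[OF rt(2) graded_power[OF h(2), of l]] PQ(2)] that
      by (simp add: graded_def P1_def)
    have gr2: "\<exists>k<l. wt \<omega> m = v + w + int k * s" if m: "m \<in> keys (P * t)" for m
    proof -
      obtain a b where "m = a + b" "a \<in> keys P" "b \<in> keys t" using m keys_mult[of P t] by blast
      with PQ(4)[of a] rt(3) show ?thesis by (auto simp: graded_def wt_add l_def)
    qed
    have "R.eval (c # cs) ?x = c * ?x ^ l + R.eval cs ?x"
      by (simp add: ring_of_type_algebra_eval_Cons l_def del: R.eval.simps)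
    also have "\<dots> = to_fract (\<Phi> (P1 + P * t)) / to_fract (\<Phi> (t * Q))"
      using rt(1) PQ(1) by (simp add: rt(4) PQ(3) P1_def psubst_add psubst_mult pow field_simps)
    finally have ev: "R.eval (c # cs) ?x = to_fract (\<Phi> (P1 + P * t)) / to_fract (\<Phi> (t * Q))" .
    have keys: "\<exists>k<length (c # cs). wt \<omega> m = v + w + int k * s" if m: "m \<in> keys (P1 + P * t)" for m
    proof (cases "m \<in> keys P1")
      case True
      then show ?thesis using gr1 by (auto simp: l_def)
    next
      case False
      then have "m \<in> keys (P * t)" using m keys_add[of P1 "P * t"] by blast
      with gr2 obtain k where "k < l" "wt \<omega> m = v + w + int k * s" by blast
      then show ?thesis by (auto simp: l_def intro: less_SucI)
    qed
    have nz: "P1 + P * t \<noteq> 0" if "c \<noteq> 0"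
    proof -
      have "r \<noteq> 0" using that rt by auto
      then have "P1 \<noteq> 0" using h PQ by (simp add: P1_def)
      then have "keys P1 \<noteq> {}" by simp
      then obtain m where m: "m \<in> keys P1" by blast
      have "m \<notin> keys (P * t)"
      proof
        assume "m \<in> keys (P * t)"
        from gr2[OF this] obtain k where "k < l" "wt \<omega> m = v + w + int k * s" by blast
        with gr1[OF m] show False using h(3) by simp
      qed
      then have "m \<in> keys (P1 + P * t)" using m by (simp add: in_keys_iff lookup_add)
      then show ?thesis by auto
    qed
    show ?case
      by (intro exI[of _ "P1 + P * t"] exI[of _ "t * Q"] exI[of _ "v + w"])
         (use ev keys nz rt(1) PQ(1) graded_mult[OF rt(3) PQ(2)] in auto)
  qed
  note main = this
  have sub: "subfield (adjoin A) ?R"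
    unfolding adjoin_def by (rule R.generate_field_is_subfield) simp
  assume "R.algebraic (adjoin A) ?x"
  then obtain p where p: "p \<in> carrier ((adjoin A)[X]\<^bsub>?R\<^esub>)" "p \<noteq> []" "R.eval p ?x = 0"
    using R.algebraicE[OF subfieldE(1)[OF sub], of ?x] by (auto simp: over_def)
  then have "set p \<subseteq> wfield \<omega> 0" "hd p \<noteq> 0"
    using adjoin_subset_wfield[OF A] by (auto simp: univ_poly_def polynomial_def)
  from main[OF this(1)] this(2) p(2,3) show False by auto
qed

end

section \<open>Roots of unity\<close>

lemma primitive_root_nonzero: "primitive_root_of_unity n \<zeta> \<Longrightarrow> \<zeta> \<noteq> 0"
  by (auto simp: primitive_root_of_unity_def zero_power)

lemma primitive_root_powi_eq_1_iff:
  assumes "primitive_root_of_unity n \<zeta>"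
  shows "\<zeta> powi k = 1 \<longleftrightarrow> int n dvd k"
proof -
  have n: "n > 0" "\<zeta> ^ n = 1" "\<And>j. 0 < j \<Longrightarrow> j < n \<Longrightarrow> \<zeta> ^ j \<noteq> 1"
    using assms by (auto simp: primitive_root_of_unity_def)
  have nz: "\<zeta> \<noteq> 0" using assms by (rule primitive_root_nonzero)
  have "\<zeta> powi k = \<zeta> powi (int n * (k div int n) + k mod int n)" by simp
  also have "\<dots> = (\<zeta> powi int n) powi (k div int n) * \<zeta> powi (k mod int n)"
    using nz by (subst power_int_add) (simp_all add: power_int_mult)
  also have "\<dots> = \<zeta> powi (k mod int n)" by (simp add: n)
  also have "\<dots> = \<zeta> ^ nat (k mod int n)" using n by (simp add: power_int_def)
  finally have *: "\<zeta> powi k = \<zeta> ^ nat (k mod int n)" .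
  show ?thesis
  proof
    assume "\<zeta> powi k = 1"
    moreover have "0 \<le> k mod int n" "k mod int n < int n" using n(1) by simp_all
    ultimately have "k mod int n = 0" using n(3)[of "nat (k mod int n)"] * by (cases "k mod int n = 0") auto
    then show "int n dvd k" by (simp add: dvd_eq_mod_eq_0)
  qed (simp add: *)
qed

lemma primitive_root_powi_eq_iff:
  assumes "primitive_root_of_unity n \<zeta>"
  shows "\<zeta> powi k = \<zeta> powi l \<longleftrightarrow> int n dvd k - l"
proof -
  have "\<zeta> \<noteq> 0" using assms by (rule primitive_root_nonzero)
  then have "\<zeta> powi k = \<zeta> powi l \<longleftrightarrow> \<zeta> powi (k - l) = 1" by (simp add: power_int_diff)
  then show ?thesis by (simp add: primitive_root_powi_eq_1_iff[OF assms])
qed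

lemma sum_primitive_root_powi:
  assumes "primitive_root_of_unity n \<zeta>"
  shows "(\<Sum>g<n. \<zeta> powi (k * int g)) = (if int n dvd k then of_nat n else 0)"
proof -
  define x where "x = \<zeta> powi k"
  have "(\<Sum>g<n. \<zeta> powi (k * int g)) = (\<Sum>g<n. x ^ g)" by (simp add: power_int_mult x_def)
  moreover have "x ^ n = 1"
  proof -
    have "x ^ n = \<zeta> powi (k * int n)" by (simp add: x_def power_int_mult)
    then show ?thesis using primitive_root_powi_eq_1_iff[OF assms] by simp
  qed
  moreover have "x = 1 \<longleftrightarrow> int n dvd k" using primitive_root_powi_eq_1_iff[OF assms] by (simp add: x_def)
  ultimately show ?thesis using geometric_sum[of x n] by (cases "x = 1") auto
qed

section \<open>Diagonalization\<close>

lemma vector_matrix_mult_scale: "(c *s l) v* A = c *s (l v* (A :: 'k::field ^ 'n ^ 'm))"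
  by (simp add: vec_eq_iff vector_matrix_mult_def sum_distrib_left algebra_simps)

lemma vector_matrix_mult_sum: "(\<Sum>x\<in>I. f x) v* A = (\<Sum>x\<in>I. f x v* (A :: 'k::field ^ 'n ^ 'm))"
  by (induction I rule: infinite_finite_induct) (simp_all add: vector_matrix_left_distrib)

lemma matrix_mult_row: "(A ** B) $ i = A $ i v* (B :: 'k::field ^ 'n ^ 'm)"
  by (simp add: vec_eq_iff matrix_matrix_mult_def vector_matrix_mult_def mult.commute)

lemma mat_1_row: "(mat 1 :: 'k::field ^ 'n ^ 'n) $ i = axis i 1"
  by (simp add: vec_eq_iff axis_def mat_def)

lemma axis_vector_matrix_mult: "axis i 1 v* A = (A :: 'k::field ^ 'n ^ 'm) $ i"
  by (simp flip: matrix_mult_row mat_1_row)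

lemma hom_GL_simps:
  assumes "n > 0" "\<rho> \<in> hom (integer_mod_group n) (GL :: ('k::field ^ 'v ^ 'v) monoid)"
  shows hom_GL_mult: "a \<in> {0..<int n} \<Longrightarrow> b \<in> {0..<int n} \<Longrightarrow> \<rho> ((a + b) mod int n) = \<rho> a ** \<rho> b"
    and hom_GL_0: "\<rho> 0 = mat 1"
proof -
  show mult: "\<rho> ((a + b) mod int n) = \<rho> a ** \<rho> b" if "a \<in> {0..<int n}" "b \<in> {0..<int n}" for a b
    using assms that by (simp add: hom_def carrier_integer_mod_group GL_def)
  have "invertible (\<rho> 0)" using assms by (auto simp: hom_def carrier_integer_mod_group GL_def)
  then obtain B where B: "\<rho> 0 ** B = mat 1" by (auto simp: invertible_def)
  have "\<rho> 0 ** \<rho> 0 = \<rho> 0" using mult[of 0 0] assms by simp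
  then have "\<rho> 0 ** (\<rho> 0 ** B) = \<rho> 0 ** B" by (simp add: matrix_mul_assoc)
  then show "\<rho> 0 = mat 1" by (simp add: B)
qed

text \<open>
  The operators \<open>proj j\<close> are, up to the invertible factor \<open>n\<close>, the projections of \<open>V\<^sup>*\<close> to its isotypic
  components. Since they add up to \<open>n\<close> times the identity, the eigenvectors span, and a basis can
  be selected among them.
\<close>

lemma exists_eigenbasis:
  fixes \<rho> :: "int \<Rightarrow> 'k::field ^ 'v ^ 'v"
  assumes root: "primitive_root_of_unity n \<zeta>" and char: "of_nat n \<noteq> (0 :: 'k)"
    and hom: "\<rho> \<in> hom (integer_mod_group n) GL"
  obtains L :: "'k ^ 'v ^ 'v" and \<theta> where "invertible L"
    "\<And>g i. g \<in> carrier (integer_mod_group n) \<Longrightarrow>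
       dual_action (integer_mod_group n) \<rho> g (L $ i) = \<zeta> powi (\<theta> i * g) *s L $ i"
proof -
  have n: "n > 0" using root by (simp add: primitive_root_of_unity_def)
  have nz: "\<zeta> \<noteq> 0" using root by (rule primitive_root_nonzero)
  \<comment> \<open>The dual action, extended from residues to all integers.\<close>
  define act where "act g l = l v* \<rho> ((- g) mod int n)" for g :: int and l :: "'k ^ 'v"
  have act_dual: "dual_action (integer_mod_group n) \<rho> g l = act g l"
    if "g \<in> carrier (integer_mod_group n)" for g l
    using that by (simp add: dual_action_def act_def)
  have act_add: "act g (act h l) = act (g + h) l" for g h l
  proof -
    have "act g (act h l) = l v* (\<rho> ((- h) mod int n) ** \<rho> ((- g) mod int n))"
      by (simp add: act_def vector_matrix_mul_assoc)
    also have "\<rho> ((- h) mod int n) ** \<rho> ((- g) mod int n) = \<rho> (((- h) mod int n + (- g) mod int n) mod int n)"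
      using n by (intro hom_GL_mult[OF n hom, symmetric]) auto
    also have "((- h) mod int n + (- g) mod int n) mod int n = (- (g + h)) mod int n"
      using mod_add_eq[of "- h" "int n" "- g"] by (simp only: minus_add_distrib add.commute)
    finally show ?thesis by (simp add: act_def)
  qed
  have act_mod: "act (g mod int n) l = act g l" for g l
    by (simp add: act_def mod_minus_eq)
  define proj where "proj j l = (\<Sum>g<n. \<zeta> powi (- j * int g) *s act (int g) l)" for j l
  have act_proj: "act h (proj j l) = \<zeta> powi (j * h) *s proj j l" for h j l
  proof -
    define F where "F g = \<zeta> powi (- j * g) *s act g l" for g
    have F_mod: "F (g mod int n) = F g" for g
    proof -
      have "int n dvd (- j * (g mod int n)) - (- j * g)"
        by (simp add: minus_mod_eq_mult_div[symmetric] right_diff_distrib[symmetric] flip: minus_mult_right)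
      then have "\<zeta> powi (- j * (g mod int n)) = \<zeta> powi (- j * g)"
        using primitive_root_powi_eq_iff[OF root] by blast
      then show ?thesis by (simp add: F_def act_mod)
    qed
    have "act h (proj j l) = (\<Sum>g<n. \<zeta> powi (- j * int g) *s act (int g + h) l)"
      by (simp add: proj_def act_def[of h] vector_matrix_mult_sum vector_matrix_mult_scale)
         (simp add: act_def[of h, symmetric] act_add add.commute)
    also have "\<dots> = \<zeta> powi (j * h) *s (\<Sum>g<n. F (int g + h))"
      unfolding F_def vec.scale_sum_right
      by (intro sum.cong refl) (simp add: power_int_add[symmetric] nz algebra_simps)
    also have "(\<Sum>g<n. F (int g + h)) = (\<Sum>g\<in>{0..<int n}. F ((g + h) mod int n))"
      by (simp add: F_mod sum.atLeast_int_lessThan_int_shift[of _ 0, simplified] atLeast0LessThan o_def)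
    also have "\<dots> = (\<Sum>g\<in>{0..<int n}. F g)"
    proof (rule sum.reindex_bij_witness[of _ "\<lambda>g. (g - h) mod int n" "\<lambda>g. (g + h) mod int n"])
    qed (use n in \<open>auto simp: mod_diff_left_eq mod_add_left_eq\<close>)
    also have "\<dots> = proj j l"
      by (simp add: sum.atLeast_int_lessThan_int_shift[of _ 0, simplified] atLeast0LessThan o_def proj_def F_def)
    finally show ?thesis .
  qed
  have sum_proj: "(\<Sum>j<n. proj (int j) l) = of_nat n *s l" for l
  proof -
    have "(\<Sum>j<n. proj (int j) l) = (\<Sum>g<n. (\<Sum>j<n. \<zeta> powi (- int g * int j)) *s act (int g) l)"
      unfolding proj_def vec.scale_sum_left by (subst sum.swap) (simp add: mult.commute)
    also have "\<dots> = (\<Sum>g<n. if g = 0 then of_nat n *s act 0 l else 0)"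
      by (intro sum.cong refl, subst sum_primitive_root_powi[OF root])
         (auto dest: zdvd_imp_le)
    also have "\<dots> = of_nat n *s l"
      using n by (simp add: act_def hom_GL_0[OF n hom])
    finally show ?thesis .
  qed
  define E where "E = {l. \<exists>j. \<forall>g. act g l = \<zeta> powi (j * g) *s l}"
  have "vec.span E = UNIV"
  proof -
    have "l \<in> vec.span E" for l
    proof -
      have "l = inverse (of_nat n) *s (\<Sum>j<n. proj (int j) l)"
        by (simp add: sum_proj char)
      also have "\<dots> \<in> vec.span E"
        by (intro vec.span_scale vec.span_sum vec.span_base) (auto simp: E_def act_proj)
      finally show ?thesis .
    qed
    then show ?thesis by auto
  qed
  obtain B where B: "B \<subseteq> E" "vec.independent B" "E \<subseteq> vec.span B" "card B = vec.dim E"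
    using vec.basis_exists[of E] .
  have span_B: "vec.span B = UNIV"
    using vec.span_mono[OF B(3)] \<open>vec.span E = UNIV\<close> by (auto simp: vec.span_span)
  have "card B = CARD('v)"
    using B(4) vec.dim_span[of E] unfolding \<open>vec.span E = UNIV\<close> vec_dim_card by metis
  moreover have "finite B" using B(2) by (rule vec.finiteI_independent)
  ultimately obtain f where f: "bij_betw f (UNIV :: 'v set) B"
    using finite_same_card_bij[of "UNIV :: 'v set" B] by auto
  define L where "L = (\<chi> i. f i)"
  have "rows L = B"
    using f by (auto simp: rows_def row_def L_def bij_betw_def vec_lambda_eta)
  then have "invertible L"
    using matrix_left_invertible_span_rows_gen[of L] span_B invertible_left_inverse[of L] by simp
  have "f i \<in> E" for i using f B(1) by (auto simp: bij_betw_def)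
  then have "\<exists>j. \<forall>g. act g (L $ i) = \<zeta> powi (j * g) *s L $ i" for i by (simp add: E_def L_def)
  then obtain \<theta> where "\<And>i g. act g (L $ i) = \<zeta> powi (\<theta> i * g) *s L $ i" by metis
  with that[of L \<theta>] \<open>invertible L\<close> act_dual show thesis by auto
qed

lemma psubst_linear_form: "psubst a (linear_form l) = (\<Sum>i\<in>UNIV. mpoly_const (l $ i) * a i)"
  by (simp add: linear_form_def psubst_sum psubst_mult)

lemma linear_form_axis: "linear_form (axis i 1) = mpoly_var i"
proof -
  have "linear_form (axis i 1) = (\<Sum>j\<in>UNIV. if j = i then mpoly_var j else 0)"
    unfolding linear_form_def by (intro sum.cong refl) (simp add: axis_def)
  then show ?thesis by simp
qed

lemma linear_form_scale: "linear_form (c *s l) = mpoly_const c * linear_form l"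
  by (simp add: linear_form_def sum_distrib_left mpoly_const_mult mult.assoc)

lemma psubst_linear_form_matrix:
  fixes A :: "'k::field ^ 'v ^ 'v"
  shows "psubst (\<lambda>i. linear_form (A $ i)) (linear_form l) = linear_form (l v* A)"
proof -
  have const_sum: "mpoly_const (sum f I) = (\<Sum>x\<in>I. mpoly_const (f x))" for f :: "'c \<Rightarrow> 'k" and I
    by (induction I rule: infinite_finite_induct) (simp_all add: mpoly_const_add)
  have "psubst (\<lambda>i. linear_form (A $ i)) (linear_form l) =
      (\<Sum>i\<in>UNIV. \<Sum>j\<in>UNIV. mpoly_const (l $ i * A $ i $ j) * mpoly_var j)"
    unfolding psubst_linear_form unfolding linear_form_def
    by (simp add: sum_distrib_left mpoly_const_mult mult.assoc)
  also have "\<dots> = linear_form (l v* A)"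
    by (subst sum.swap)
       (simp add: linear_form_def vector_matrix_mult_def const_sum sum_distrib_right sum_distrib_left mult.commute)
  finally show ?thesis .
qed

lemma mpoly_degree_linear_form: "mpoly_degree (linear_form l) \<le> 1"
  unfolding linear_form_def
proof (rule mpoly_degree_sum_le)
  fix i
  have "mpoly_degree (mpoly_var i :: ('a, 'b) mpoly) \<le> 1"
    by (simp add: mpoly_degree_le_iff mpoly_var_def mdeg_def)
  then show "mpoly_degree (mpoly_const (l $ i) * mpoly_var i) \<le> 1"
    using mpoly_degree_mult_le[of "mpoly_const (l $ i)" "mpoly_var i"] by simp
qed

lemma linear_coordinates_matrix:
  fixes L L' :: "'k::field ^ 'v::{finite,linorder} ^ 'v::{finite,linorder}"
  assumes "L ** L' = mat 1" "L' ** L = mat 1"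
  shows "linear_coordinates (\<lambda>i. linear_form (L $ i)) (\<lambda>i. linear_form (L' $ i))"
proof
  show "psubst (\<lambda>i. linear_form (L $ i)) (linear_form (L' $ i)) = mpoly_var i"
    "psubst (\<lambda>i. linear_form (L' $ i)) (linear_form (L $ i)) = mpoly_var i" for i
    unfolding psubst_linear_form_matrix matrix_mult_row[symmetric] assms mat_1_row linear_form_axis
    by (rule refl)+
qed (rule mpoly_degree_linear_form)+

section \<open>Invariants of a diagonalized representation\<close>

locale diagonal_representation = linear_coordinates y z
  for y z :: "'v::{finite,linorder} \<Rightarrow> ('v, 'k::field) mpoly" +
  fixes n :: nat and \<zeta> :: 'k and \<rho> :: "int \<Rightarrow> 'k ^ 'v::{finite,linorder} ^ 'v::{finite,linorder}" and \<theta> :: "'v \<Rightarrow> int"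
  assumes root: "primitive_root_of_unity n \<zeta>"
    and char: "of_nat n \<noteq> (0 :: 'k)"
    and action_y: "g \<in> carrier (integer_mod_group n) \<Longrightarrow>
      mpoly_action (integer_mod_group n) \<rho> g (y i) = mpoly_const (\<zeta> powi (\<theta> i * g)) * y i"
begin

abbreviation G :: "int monoid" where "G \<equiv> integer_mod_group n"

lemma n_pos: "n > 0"
  using root by (simp add: primitive_root_of_unity_def)

lemma \<zeta>_nonzero: "\<zeta> \<noteq> 0"
  using root by (rule primitive_root_nonzero)

text \<open>
  The action of \<open>g\<close> in the coordinates \<open>y\<close>, where it only rescales monomials
  (\<open>lookup_twist\<close>, \<open>mpoly_action_\<Phi>\<close>).
\<close>

definition twist :: "int \<Rightarrow> ('v, 'k) mpoly \<Rightarrow> ('v, 'k) mpoly" where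
  "twist g = psubst (\<lambda>i. mpoly_const (\<zeta> powi (\<theta> i * g)) * mpoly_var i)"

lemma lookup_twist: "lookup (twist g p) m = \<zeta> powi (g * wt \<theta> m) * lookup p m"
proof -
  have const_prod: "(\<Prod>i\<in>I. mpoly_const (f i)) = (mpoly_const (\<Prod>i\<in>I. f i) :: ('v, 'k) mpoly)"
    for f :: "'v \<Rightarrow> 'k" and I
    by (induction I rule: infinite_finite_induct) (simp_all add: mpoly_const_mult)
  have const_power: "mpoly_const c ^ k = (mpoly_const (c ^ k) :: ('v, 'k) mpoly)" for c :: 'k and k
    by (induction k) (simp_all add: mpoly_const_mult)
  have powi_sum: "(\<Prod>i\<in>I. \<zeta> powi (f i)) = \<zeta> powi (sum f I)" for f :: "'v \<Rightarrow> int" and I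
    by (induction I rule: infinite_finite_induct) (simp_all add: power_int_add \<zeta>_nonzero)
  have "mon_eval (\<lambda>i. mpoly_const (\<zeta> powi (\<theta> i * g)) * mpoly_var i) m =
      (mpoly_const (\<zeta> powi (g * wt \<theta> m)) :: ('v, 'k) mpoly) * mon_eval mpoly_var m" for m
  proof -
    have "(\<zeta> powi (\<theta> i * g)) ^ k = \<zeta> powi (g * (\<theta> i * int k))" for i k
      by (simp add: power_int_mult[symmetric] algebra_simps flip: power_int_of_nat)
    then show ?thesis
      by (simp add: mon_eval_UNIV power_mult_distrib prod.distrib const_power const_prod powi_sum
          wt_def sum_distrib_left)
  qed
  then have "twist g p = (\<Sum>m\<in>keys p. Poly_Mapping.single m (\<zeta> powi (g * wt \<theta> m) * lookup p m))"
    by (simp add: twist_def psubst_keys single_eq_mon_eval mpoly_const_mult algebra_simps)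
  then show ?thesis by (simp add: lookup_sum lookup_single when_def in_keys_iff)
qed

lemma twist_eq_0_iff [simp]: "twist g p = 0 \<longleftrightarrow> p = 0"
  by (simp add: poly_mapping_eq_iff fun_eq_iff lookup_twist \<zeta>_nonzero)

lemma mpoly_action_\<Phi>:
  assumes "g \<in> carrier G"
  shows "mpoly_action G \<rho> g (\<Phi> p) = \<Phi> (twist g p)"
proof -
  let ?a = "\<lambda>i. linear_form (dual_action G \<rho> g (axis i 1))"
  have act: "mpoly_action G \<rho> g = psubst ?a" by (simp add: fun_eq_iff mpoly_action_def psubst_def)
  have "psubst ?a (y i) = \<Phi> (mpoly_const (\<zeta> powi (\<theta> i * g)) * mpoly_var i)" for i
    using action_y[OF assms, of i] by (simp add: act psubst_mult)
  then show ?thesis by (simp add: act twist_def psubst_psubst)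
qed

lemma ratfun_action_\<Phi>:
  assumes g: "g \<in> carrier G" and q: "q \<noteq> 0"
  shows "ratfun_action G \<rho> g (to_fract (\<Phi> p) / to_fract (\<Phi> q)) =
    to_fract (\<Phi> (twist g p)) / to_fract (\<Phi> (twist g q))" (is "_ = ?rhs")
  unfolding ratfun_action_def
proof (rule the_equality)
  show "\<exists>p' q'. q' \<noteq> 0 \<and> to_fract (\<Phi> p) / to_fract (\<Phi> q) = Fract p' q' \<and>
      ?rhs = Fract (mpoly_action G \<rho> g p') (mpoly_action G \<rho> g q')"
    by (intro exI[of _ "\<Phi> p"] exI[of _ "\<Phi> q"])
       (simp add: q Fract_conv_to_fract mpoly_action_\<Phi>[OF g])
next
  fix h
  assume "\<exists>p' q'. q' \<noteq> 0 \<and> to_fract (\<Phi> p) / to_fract (\<Phi> q) = Fract p' q' \<and>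
      h = Fract (mpoly_action G \<rho> g p') (mpoly_action G \<rho> g q')"
  then obtain p' q' where pq': "q' \<noteq> 0" "to_fract (\<Phi> p) / to_fract (\<Phi> q) = Fract p' q'"
    "h = Fract (mpoly_action G \<rho> g p') (mpoly_action G \<rho> g q')" by blast
  define r s where "r = psubst z p'" and "s = psubst z q'"
  then have rs_conv: "p' = \<Phi> r" "q' = \<Phi> s" by simp_all
  have rs: "s \<noteq> 0" "to_fract (\<Phi> p) / to_fract (\<Phi> q) = to_fract (\<Phi> r) / to_fract (\<Phi> s)"
    "h = Fract (mpoly_action G \<rho> g (\<Phi> r)) (mpoly_action G \<rho> g (\<Phi> s))"
    using pq' by (simp_all add: rs_conv Fract_conv_to_fract)
  then have "to_fract (\<Phi> (p * s)) = to_fract (\<Phi> (r * q))"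
    using q by (simp add: psubst_mult field_simps)
  then have "p * s = r * q" by simp
  from arg_cong[OF this, of "twist g"] have "twist g p * twist g s = twist g r * twist g q"
    by (simp add: twist_def psubst_mult)
  then have "to_fract (\<Phi> (twist g p * twist g s)) = to_fract (\<Phi> (twist g r * twist g q))" by simp
  then show "h = ?rhs"
    using q rs(1) by (simp add: rs(3) mpoly_action_\<Phi>[OF g] Fract_conv_to_fract psubst_mult field_simps)
qed

lemma carrier_conv: "g \<in> carrier G \<longleftrightarrow> 0 \<le> g \<and> g < int n"
  using n_pos by (simp add: carrier_integer_mod_group)

text \<open>
  Invariance of \<open>p / q\<close> means \<open>twist g p * q = p * twist g q\<close> for all \<open>g\<close>. Averaging this against a
  character replaces \<open>p\<close> and \<open>q\<close> by their components of one weight \<open>c\<close> and leaves the fraction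
  unchanged; the weight is chosen such that the component of \<open>q\<close> does not vanish. The
  inclusions of the sets of monomials are what controls degrees in the lower bound.
\<close>

lemma invariants_graded_fraction:
  assumes f: "f \<in> invariants G \<rho>" "f = to_fract (\<Phi> p) / to_fract (\<Phi> q)" and q: "q \<noteq> 0"
  obtains p' q' c where "q' \<noteq> 0" "keys p' \<subseteq> keys p" "keys q' \<subseteq> keys q"
    "graded \<theta> (int n) c p'" "graded \<theta> (int n) c q'" "f = to_fract (\<Phi> p') / to_fract (\<Phi> q')"
proof -
  have twist: "twist g p * q = p * twist g q" if "g \<in> carrier G" for g
  proof -
    have "to_fract (\<Phi> (twist g p)) / to_fract (\<Phi> (twist g q)) = to_fract (\<Phi> p) / to_fract (\<Phi> q)"
      using f(1) ratfun_action_\<Phi>[OF that q, of p] that by (simp add: invariants_def f(2))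
    then have "to_fract (\<Phi> (twist g p * q)) = to_fract (\<Phi> (p * twist g q))"
      using q by (simp add: psubst_mult field_simps)
    then show ?thesis by simp
  qed
  define proj where
    "proj c p = (\<Sum>g<n. mpoly_const (\<zeta> powi (- c * int g)) * twist (int g) p)" for c p
  have lookup_proj: "lookup (proj c p) m = (if int n dvd wt \<theta> m - c then of_nat n * lookup p m else 0)"
    for c p m
  proof -
    have "lookup (proj c p) m = (\<Sum>g<n. \<zeta> powi ((wt \<theta> m - c) * int g)) * lookup p m"
      unfolding proj_def lookup_sum sum_distrib_right lookup_mpoly_const_mult lookup_twist
      by (intro sum.cong refl) (simp add: \<zeta>_nonzero algebra_simps flip: power_int_add mult.assoc)
    then show ?thesis by (simp add: sum_primitive_root_powi[OF root])
  qed
  from q have "keys q \<noteq> {}" by simp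
  then obtain m0 where m0: "m0 \<in> keys q" by blast
  define c where "c = wt \<theta> m0"
  have proj_eq: "proj c p * q = p * proj c q"
    unfolding proj_def sum_distrib_left sum_distrib_right
    by (intro sum.cong refl) (use twist carrier_conv in \<open>simp add: algebra_simps\<close>)
  have nz: "proj c q \<noteq> 0"
  proof
    assume "proj c q = 0"
    then have "lookup (proj c q) m0 = 0" by simp
    then show False using m0 char by (simp add: lookup_proj c_def in_keys_iff)
  qed
  have "to_fract (\<Phi> (proj c p * q)) = to_fract (\<Phi> (p * proj c q))" by (simp only: proj_eq)
  then have "f = to_fract (\<Phi> (proj c p)) / to_fract (\<Phi> (proj c q))"
    using q nz by (simp add: f(2) psubst_mult field_simps)
  moreover have "keys (proj c p) \<subseteq> keys p" "graded \<theta> (int n) c (proj c p)" for p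
    by (auto simp: in_keys_iff lookup_proj graded_def split: if_splits)
  ultimately show thesis using that nz by blast
qed

lemma invariants_eq_wfield: "invariants G \<rho> = wfield \<theta> (int n)"
proof (intro equalityI subsetI)
  fix f assume f: "f \<in> invariants G \<rho>"
  obtain p q where "q \<noteq> 0" "f = to_fract (\<Phi> p) / to_fract (\<Phi> q)"
    using ratfun_degree_attained_\<Phi> by blast
  then show "f \<in> wfield \<theta> (int n)"
    using invariants_graded_fraction[OF f, of p q] by (metis wfieldI)
next
  fix f assume "f \<in> wfield \<theta> (int n)"
  then obtain p q c where f: "q \<noteq> 0" "graded \<theta> (int n) c p" "graded \<theta> (int n) c q"
    "f = to_fract (\<Phi> p) / to_fract (\<Phi> q)" by (rule wfieldE)
  have tw: "twist g r = mpoly_const (\<zeta> powi (g * c)) * r" if r: "graded \<theta> (int n) c r" for g r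
  proof (rule poly_mapping_eqI)
    fix m
    have "\<zeta> powi (g * wt \<theta> m) = \<zeta> powi (g * c)" if "m \<in> keys r"
      using r that primitive_root_powi_eq_iff[OF root]
      by (simp add: graded_def right_diff_distrib[symmetric])
    then show "lookup (twist g r) m = lookup (mpoly_const (\<zeta> powi (g * c)) * r) m"
      by (cases "m \<in> keys r") (auto simp: lookup_twist lookup_mpoly_const_mult in_keys_iff)
  qed
  show "f \<in> invariants G \<rho>"
    unfolding invariants_def
  proof (intro CollectI ballI)
    fix g assume "g \<in> carrier G"
    then show "ratfun_action G \<rho> g f = f"
      using f(1) by (simp add: f(4) ratfun_action_\<Phi> tw[OF f(2)] tw[OF f(3)] psubst_mult \<zeta>_nonzero)
  qed
qed

text \<open>
  This is where degrees enter the lower bound: exponents of the numerator and of the denominator of an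
  invariant of degree at most \<open>d\<close> differ by lattice vectors of \<open>l\<^sub>1\<close>-norm at most \<open>d\<close>, and \<open>\<omega>\<close> vanishes on these.
\<close>

lemma invariants_le_subset_wfield:
  assumes "\<And>e. (\<Sum>i\<in>UNIV. \<bar>e i\<bar>) \<le> int d \<Longrightarrow> int n dvd (\<Sum>i\<in>UNIV. \<theta> i * e i) \<Longrightarrow>
    (\<Sum>i\<in>UNIV. \<omega> i * e i) = 0"
  shows "invariants_le G \<rho> d \<subseteq> wfield \<omega> 0"
proof
  fix f assume "f \<in> invariants_le G \<rho> d"
  then have f: "f \<in> invariants G \<rho>" "ratfun_degree f \<le> d" by (auto simp: invariants_le_def)
  obtain p q where pq: "q \<noteq> 0" "f = to_fract (\<Phi> p) / to_fract (\<Phi> q)"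
    "ratfun_degree f = mpoly_degree p + mpoly_degree q"
    using ratfun_degree_attained_\<Phi> .
  obtain p' q' c where pq': "q' \<noteq> 0" "keys p' \<subseteq> keys p" "keys q' \<subseteq> keys q"
    "graded \<theta> (int n) c p'" "graded \<theta> (int n) c q'" "f = to_fract (\<Phi> p') / to_fract (\<Phi> q')"
    using invariants_graded_fraction[OF f(1) pq(2,1)] .
  show "f \<in> wfield \<omega> 0"
  proof (cases "p' = 0")
    case True
    then show ?thesis using wfield_const[of 0] by (simp add: pq'(6))
  next
    case False
    \<comment> \<open>Comparing all numerator exponents with all denominator exponents also shows that each of the two polynomials is homogeneous.\<close>
    have eq: "wt \<omega> a = wt \<omega> b" if ab: "a \<in> keys p'" "b \<in> keys q'" for a b
    proof -
      let ?e = "\<lambda>i. int (lookup a i) - int (lookup b i)"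
      have "(\<Sum>i\<in>UNIV. \<bar>?e i\<bar>) \<le> (\<Sum>i\<in>UNIV. int (lookup a i) + int (lookup b i))"
        by (rule sum_mono) auto
      also have "\<dots> = int (mdeg a + mdeg b)" by (simp add: mdeg_UNIV sum.distrib)
      also have "mdeg a + mdeg b \<le> d"
        using ab pq'(2,3) mdeg_le_mpoly_degree[of a p] mdeg_le_mpoly_degree[of b q] f(2) pq(3) by force
      finally have "(\<Sum>i\<in>UNIV. \<bar>?e i\<bar>) \<le> int d" by simp
      moreover have "int n dvd (\<Sum>i\<in>UNIV. \<theta> i * ?e i)"
      proof -
        have "int n dvd wt \<theta> a - c" "int n dvd wt \<theta> b - c"
          using pq'(4,5) ab by (auto simp: graded_def)
        from dvd_diff[OF this] show ?thesis by (simp add: wt_def right_diff_distrib sum_subtractf)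
      qed
      ultimately have "(\<Sum>i\<in>UNIV. \<omega> i * ?e i) = 0" by (rule assms)
      then show ?thesis by (simp add: wt_def right_diff_distrib sum_subtractf)
    qed
    from False pq'(1) have "keys p' \<noteq> {}" "keys q' \<noteq> {}" by simp_all
    then obtain a b where "a \<in> keys p'" "b \<in> keys q'" by blast
    with eq have "graded \<omega> 0 (wt \<omega> a) p'" "graded \<omega> 0 (wt \<omega> a) q'"
      unfolding graded_def by (metis diff_self dvd_0_right)+
    from wfieldI[OF pq'(1) this pq'(6)] show ?thesis .
  qed
qed

lemma y_power_in_invariants: "to_fract (\<Phi> (mpoly_var i ^ n)) \<in> invariants G \<rho>"
proof -
  have "to_fract (\<Phi> (mpoly_var i ^ n)) = to_fract (\<Phi> (mpoly_var i ^ n)) / to_fract (\<Phi> 1)" by simp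
  moreover have "graded \<theta> (int n) 0 (mpoly_var i ^ n :: ('v, 'k) mpoly)"
  proof -
    have "graded \<theta> (int n) (int n * wt \<theta> (Poly_Mapping.single i 1)) (mpoly_var i ^ n :: ('v, 'k) mpoly)"
      unfolding mpoly_var_def by (intro graded_power graded_single)
    then show ?thesis by (auto simp: graded_def) (metis dvd_add_right_iff dvd_triv_left diff_add_cancel add.commute)
  qed
  moreover have "graded \<theta> (int n) 0 (1 :: ('v, 'k) mpoly)"
    using graded_const[of \<theta> "int n" "1::'k"] by simp
  ultimately show ?thesis unfolding invariants_eq_wfield by (metis wfieldI zero_neq_one)
qed

text \<open>
  The witness is the invariant \<open>y a ^ n\<close>: its \<open>\<omega>\<close>-weight is nonzero, so it is transcendental over the field that
  contains all invariants of degree at most \<open>d\<close>.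
\<close>

lemma low_degree_invariants_not_generating:
  assumes "\<And>e. (\<Sum>i\<in>UNIV. \<bar>e i\<bar>) \<le> int d \<Longrightarrow> int n dvd (\<Sum>i\<in>UNIV. \<theta> i * e i) \<Longrightarrow>
    (\<Sum>i\<in>UNIV. \<omega> i * e i) = 0"
    and "\<omega> a \<noteq> 0"
  shows "adjoin (invariants_le G \<rho> d) \<noteq> invariants G \<rho>"
    and "T \<subseteq> invariants_le G \<rho> d \<Longrightarrow> \<not> transcendence_basis T (invariants G \<rho>)"
proof -
  let ?h = "to_fract (\<Phi> (mpoly_var a ^ n))"
  have sub: "invariants_le G \<rho> d \<subseteq> wfield \<omega> 0" by (rule invariants_le_subset_wfield) (rule assms)
  have wt_a: "wt \<omega> (Poly_Mapping.single a 1) = \<omega> a"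
    by (simp add: wt_def lookup_single when_def if_distrib cong: if_cong)
  have nz: "(mpoly_var a ^ n :: ('v, 'k) mpoly) \<noteq> 0"
  proof -
    have "(mpoly_var a :: ('v, 'k) mpoly) \<noteq> 0"
      unfolding mpoly_var_def by (metis lookup_single_eq lookup_zero zero_neq_one)
    then show ?thesis by simp
  qed
  have gr: "graded \<omega> 0 (int n * \<omega> a) (mpoly_var a ^ n :: ('v, 'k) mpoly)"
    unfolding wt_a[symmetric] unfolding mpoly_var_def by (intro graded_power graded_single)
  have "int n * \<omega> a \<noteq> 0" using n_pos assms(2) by simp
  note transc = not_algebraic_over_wfield[OF nz gr this]
  show "adjoin (invariants_le G \<rho> d) \<noteq> invariants G \<rho>"
    using transc[OF sub] y_power_in_invariants[of a] algebraic_adjoin_self by metis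
  assume "T \<subseteq> invariants_le G \<rho> d"
  with sub have "T \<subseteq> wfield \<omega> 0" by blast
  from transc[OF this] show "\<not> transcendence_basis T (invariants G \<rho>)"
    using y_power_in_invariants[of a] by (auto simp: transcendence_basis_def)
qed

end

section \<open>The lattice of invariant exponents\<close>

text \<open>
  Over the rationals, \<open>u\<close> has a left inverse, and for square matrices this is a right inverse as well.
\<close>

lemma rows_independent_if_multiples_spanned:
  fixes u :: "'v::finite \<Rightarrow> 'v \<Rightarrow> int"
  assumes "n > 0" and span: "\<And>j. \<exists>c. \<forall>k. (\<Sum>i\<in>UNIV. c i * u i k) = (if k = j then int n else 0)"
    and zero: "\<And>k. (\<Sum>i\<in>UNIV. d i * u i k) = 0"
  shows "d = (\<lambda>i. 0)"
proof -
  obtain c where c: "\<And>j k. (\<Sum>i\<in>UNIV. c j i * u i k) = (if k = j then int n else 0)"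
    using span by metis
  define U :: "rat ^ 'v ^ 'v" where "U = (\<chi> i k. of_int (u i k))"
  define C :: "rat ^ 'v ^ 'v" where "C = (\<chi> j i. of_int (c j i) / of_nat n)"
  define x :: "rat ^ 'v" where "x = (\<chi> i. of_int (d i))"
  have "C ** U = mat 1"
  proof -
    have "(\<Sum>i\<in>UNIV. of_int (c j i) / of_nat n * of_int (u i k)) = (if j = k then 1 else 0 :: rat)" for j k
    proof -
      have "(\<Sum>i\<in>UNIV. of_int (c j i) / of_nat n * of_int (u i k)) =
          (of_int (\<Sum>i\<in>UNIV. c j i * u i k) / of_nat n :: rat)"
        by (simp add: sum_divide_distrib)
      then show ?thesis using \<open>n > 0\<close> by (auto simp: c)
    qed
    then show ?thesis by (simp add: C_def U_def matrix_matrix_mult_def mat_def vec_eq_iff)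
  qed
  then have "U ** C = mat 1" by (rule matrix_left_right_inverse[THEN iffD1])
  moreover have "x v* U = 0"
  proof -
    have "(\<Sum>i\<in>UNIV. of_int (u i k) * of_int (d i)) = (of_int (\<Sum>i\<in>UNIV. d i * u i k) :: rat)" for k
      by (simp add: mult.commute)
    then show ?thesis unfolding zero by (simp add: x_def U_def vector_matrix_mult_def vec_eq_iff mult.commute)
  qed
  ultimately have "x = 0"
    by (metis vector_matrix_mul_assoc vector_matrix_mul_rid vector_matrix_mult_0)
  then show ?thesis by (simp add: x_def vec_eq_iff fun_eq_iff)
qed

definition int_span :: "('v::finite \<Rightarrow> 'v \<Rightarrow> int) \<Rightarrow> ('v \<Rightarrow> int) set" where
  "int_span u = {\<lambda>k. \<Sum>i\<in>UNIV. c i * u i k |c. True}"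

lemma int_spanI: "(\<And>k. e k = (\<Sum>i\<in>UNIV. c i * u i k)) \<Longrightarrow> e \<in> int_span u"
  unfolding int_span_def by (intro CollectI exI[of _ c]) auto

lemma int_span_base: "u i \<in> int_span u"
  by (rule int_spanI[of _ "\<lambda>j. if j = i then 1 else 0"])
     (simp add: if_distrib[of "\<lambda>x. x * _"] cong: if_cong)

lemma int_span_0: "(\<lambda>k. 0) \<in> int_span u"
  by (rule int_spanI[of _ "\<lambda>j. 0"]) simp

lemma int_span_add:
  assumes "e \<in> int_span u" "f \<in> int_span u"
  shows "(\<lambda>k. e k + f k) \<in> int_span u"
proof -
  obtain c d where "e = (\<lambda>k. \<Sum>i\<in>UNIV. c i * u i k)" "f = (\<lambda>k. \<Sum>i\<in>UNIV. d i * u i k)"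
    using assms by (auto simp: int_span_def)
  then show ?thesis
    by (intro int_spanI[of _ "\<lambda>i. c i + d i"]) (simp add: distrib_right sum.distrib)
qed

lemma int_span_scale:
  assumes "e \<in> int_span u"
  shows "(\<lambda>k. a * e k) \<in> int_span u"
proof -
  obtain c where "e = (\<lambda>k. \<Sum>i\<in>UNIV. c i * u i k)" using assms by (auto simp: int_span_def)
  then show ?thesis
    by (intro int_spanI[of _ "\<lambda>i. a * c i"]) (simp add: sum_distrib_left mult.assoc)
qed

lemma int_span_sum: "(\<And>x. x \<in> I \<Longrightarrow> f x \<in> int_span u) \<Longrightarrow> (\<lambda>k. \<Sum>x\<in>I. f x k) \<in> int_span u"
proof (induction I rule: infinite_finite_induct)
  case (insert x I)
  then show ?case using int_span_add[of "f x" u "\<lambda>k. \<Sum>x\<in>I. f x k"] by simp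
qed (simp_all add: int_span_0)

lemma int_span_diff: "e \<in> int_span u \<Longrightarrow> f \<in> int_span u \<Longrightarrow> (\<lambda>k. e k - f k) \<in> int_span u"
  using int_span_add[of e u "\<lambda>k. - 1 * f k"] int_span_scale[of f u "- 1"] by simp

lemma int_dvd_small_imp_zero: "n dvd k \<Longrightarrow> \<bar>k\<bar> < n \<Longrightarrow> k = 0" for n k :: int
  using dvd_imp_le_int[of k n] by linarith

definition unit :: "'v \<Rightarrow> 'v \<Rightarrow> int" where
  "unit i j = (if j = i then 1 else 0)"

lemma sum_unit: "(\<Sum>j\<in>UNIV. f j * unit i j) = (f i :: int)" for i :: "'v::finite"
  by (simp add: unit_def if_distrib cong: if_cong)

lemma sum_abs_unit: "(\<Sum>j\<in>UNIV. \<bar>unit i j\<bar>) = 1" for i :: "'v::finite"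
  by (simp add: unit_def if_distrib cong: if_cong)

lemma sum_abs_add_le: "(\<Sum>j\<in>UNIV. \<bar>e j + f j\<bar>) \<le> (\<Sum>j\<in>UNIV. \<bar>e j\<bar>) + (\<Sum>j\<in>UNIV. \<bar>f j :: int\<bar>)"
  by (simp flip: sum.distrib add: sum_mono)

lemma sum_abs_diff_le: "(\<Sum>j\<in>UNIV. \<bar>e j - f j\<bar>) \<le> (\<Sum>j\<in>UNIV. \<bar>e j\<bar>) + (\<Sum>j\<in>UNIV. \<bar>f j :: int\<bar>)"
  by (simp flip: sum.distrib add: sum_mono)

text \<open>
  The weights occurring in the representation, reduced to the combinatorial properties that both
  bounds use. \<open>M\<close> is the largest weight, and \<open>r s\<close> is a distinguished coordinate of weight \<open>s\<close>.
\<close>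

locale interval_weights =
  fixes n M :: int and S :: "int set" and \<theta> :: "'v::finite \<Rightarrow> int" and r :: "int \<Rightarrow> 'v"
  assumes n: "n \<ge> 3" "M \<ge> 1" "2 * M \<le> n"
    and S_pos: "s \<in> S \<Longrightarrow> s \<noteq> 0" "\<And>s. 1 \<le> s \<Longrightarrow> s \<le> M \<Longrightarrow> s \<in> S"
    and S_neg: "s \<in> S \<Longrightarrow> \<bar>s\<bar> \<le> M"
    and \<theta>_in: "\<theta> i = 0 \<or> \<theta> i \<in> S"
    and r: "s \<in> S \<Longrightarrow> \<theta> (r s) = s"
begin

text \<open>
  A basis of the lattice of all \<open>e\<close> with \<open>n\<close> dividing \<open>\<Sum>i. \<theta> i * e i\<close>, with one vector for each
  coordinate. The vector of any coordinate other than \<open>r 1\<close> expresses this coordinate through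
  coordinates that have been treated before, in the order: positive weights increasing, negative
  weights, and then the coordinates that are not distinguished. The vector of \<open>r 1\<close> comes from
  division of \<open>n\<close> by \<open>M\<close>.
\<close>

definition short_basis :: "'v \<Rightarrow> 'v \<Rightarrow> int" where
  "short_basis i j =
    (let s = \<theta> i in
     if s = 0 then unit i j
     else if r s \<noteq> i then unit i j - unit (r s) j
     else if s < 0 then unit i j + unit (r (- s)) j
     else if s > 1 then unit i j - unit (r (s - 1)) j - unit (r 1) j
     else (n div M) * unit (r M) j + (if n mod M = 0 then 0 else unit (r (n mod M)) j))"

lemma one_in_S: "1 \<in> S" and M_in_S: "M \<in> S"
  using S_pos(2)[of 1] S_pos(2)[of M] n by auto

lemma \<theta>_r1: "\<theta> (r 1) = 1"
  by (rule r) (rule one_in_S)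

lemma n_mod_M: "n mod M \<noteq> 0 \<Longrightarrow> n mod M \<in> S"
  using n pos_mod_bound[of M n] pos_mod_sign[of M n] by (intro S_pos(2)) linarith+

lemma short_basis_r1: "short_basis (r 1) = (\<lambda>j. (n div M) * unit (r M) j + (if n mod M = 0 then 0 else unit (r (n mod M)) j))"
  by (simp add: short_basis_def \<theta>_r1 fun_eq_iff)

lemma neg_in_S: "s \<in> S \<Longrightarrow> s < 0 \<Longrightarrow> - s \<in> S"
  using S_neg[of s] by (intro S_pos(2)) auto

lemma pred_in_S: "s \<in> S \<Longrightarrow> s > 1 \<Longrightarrow> s - 1 \<in> S"
  using S_neg[of s] by (intro S_pos(2)) auto

lemma index_cases:
  obtains "\<theta> i = 0" | "\<theta> i \<in> S" "\<theta> i \<noteq> 0" "r (\<theta> i) \<noteq> i"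
    | "\<theta> i \<in> S" "\<theta> i < 0" "r (\<theta> i) = i" | "\<theta> i \<in> S" "\<theta> i > 1" "r (\<theta> i) = i"
    | "\<theta> i = 1" "r 1 = i"
proof -
  consider "\<theta> i = 0" | "\<theta> i < 0" | "\<theta> i = 1" | "\<theta> i > 1" by linarith
  then show thesis using that \<theta>_in[of i] by cases auto
qed

lemma short_basis_invariant: "n dvd (\<Sum>j\<in>UNIV. \<theta> j * short_basis i j)"
proof -
  define s where "s = \<theta> i"
  show ?thesis
  proof (rule index_cases[of i, folded s_def])
    assume 1: "s = 0"
    then show ?thesis by (simp add: short_basis_def s_def sum_unit)
  next
    assume 2: "s \<in> S" "s \<noteq> 0" "r s \<noteq> i"
    then have "(\<Sum>j\<in>UNIV. \<theta> j * short_basis i j) = (\<Sum>j\<in>UNIV. \<theta> j * unit i j) - (\<Sum>j\<in>UNIV. \<theta> j * unit (r s) j)"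
      by (simp add: short_basis_def s_def right_diff_distrib sum_subtractf)
    then show ?thesis using 2 by (simp add: sum_unit r s_def)
  next
    assume 3: "s \<in> S" "s < 0" "r s = i"
    then have "(\<Sum>j\<in>UNIV. \<theta> j * short_basis i j) = (\<Sum>j\<in>UNIV. \<theta> j * unit i j) + (\<Sum>j\<in>UNIV. \<theta> j * unit (r (- s)) j)"
      by (simp add: short_basis_def s_def distrib_left sum.distrib)
    then show ?thesis using 3 r[OF neg_in_S] by (simp add: sum_unit s_def)
  next
    assume 4: "s \<in> S" "s > 1" "r s = i"
    then have "(\<Sum>j\<in>UNIV. \<theta> j * short_basis i j) = (\<Sum>j\<in>UNIV. \<theta> j * unit i j) -
        (\<Sum>j\<in>UNIV. \<theta> j * unit (r (s - 1)) j) - (\<Sum>j\<in>UNIV. \<theta> j * unit (r 1) j)"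
      by (simp add: short_basis_def s_def right_diff_distrib sum_subtractf)
    then show ?thesis using 4 r[OF pred_in_S] by (simp add: sum_unit s_def \<theta>_r1)
  next
    assume 5: "s = 1" "r 1 = i"
    have "(\<Sum>j\<in>UNIV. \<theta> j * short_basis i j) = (n div M) * (\<Sum>j\<in>UNIV. \<theta> j * unit (r M) j) +
        (if n mod M = 0 then 0 else (\<Sum>j\<in>UNIV. \<theta> j * unit (r (n mod M)) j))"
      by (simp add: 5(2)[symmetric] short_basis_r1 distrib_left sum.distrib sum_distrib_left mult.left_commute)
    also have "\<dots> = n" using r[OF M_in_S] r[OF n_mod_M] by (cases "n mod M = 0") (auto simp: sum_unit)
    finally show ?thesis by simp
  qed
qed

lemma short_basis_norm:
  assumes D: "D \<ge> 3" "n \<le> D * M"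
  shows "(\<Sum>j\<in>UNIV. \<bar>short_basis i j\<bar>) \<le> D"
proof -
  define s where "s = \<theta> i"
  show ?thesis
  proof (rule index_cases[of i, folded s_def])
    assume 1: "s = 0"
    then show ?thesis using D by (simp add: short_basis_def s_def sum_abs_unit)
  next
    assume 2: "s \<in> S" "s \<noteq> 0" "r s \<noteq> i"
    then have "(\<Sum>j\<in>UNIV. \<bar>short_basis i j\<bar>) = (\<Sum>j\<in>UNIV. \<bar>unit i j - unit (r s) j\<bar>)"
      by (simp add: short_basis_def s_def)
    then show ?thesis using D sum_abs_diff_le[of "unit i" "unit (r s)"] by (simp add: sum_abs_unit)
  next
    assume 3: "s \<in> S" "s < 0" "r s = i"
    then have "(\<Sum>j\<in>UNIV. \<bar>short_basis i j\<bar>) = (\<Sum>j\<in>UNIV. \<bar>unit i j + unit (r (- s)) j\<bar>)"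
      by (simp add: short_basis_def s_def)
    then show ?thesis using D sum_abs_add_le[of "unit i" "unit (r (- s))"] by (simp add: sum_abs_unit)
  next
    assume 4: "s \<in> S" "s > 1" "r s = i"
    then have "(\<Sum>j\<in>UNIV. \<bar>short_basis i j\<bar>) = (\<Sum>j\<in>UNIV. \<bar>unit i j - unit (r (s - 1)) j - unit (r 1) j\<bar>)"
      by (simp add: short_basis_def s_def)
    then show ?thesis
      using D sum_abs_diff_le[of "\<lambda>j. unit i j - unit (r (s - 1)) j" "unit (r 1)"]
        sum_abs_diff_le[of "unit i" "unit (r (s - 1))"] by (simp add: sum_abs_unit)
  next
    assume 5: "s = 1" "r 1 = i"
    let ?R = "\<lambda>j. if n mod M = 0 then 0 else unit (r (n mod M)) j"
    have "(\<Sum>j\<in>UNIV. \<bar>short_basis i j\<bar>) \<le> (\<Sum>j\<in>UNIV. \<bar>(n div M) * unit (r M) j\<bar>) + (\<Sum>j\<in>UNIV. \<bar>?R j\<bar>)"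
      unfolding 5(2)[symmetric] short_basis_r1 by (rule sum_abs_add_le)
    also have "\<dots> = n div M + (if n mod M = 0 then 0 else 1)"
      using n by (simp add: abs_mult sum_distrib_left[symmetric] sum_abs_unit pos_imp_zdiv_nonneg_iff)
    also have "\<dots> \<le> D"
    proof -
      have eq: "n = n div M * M + n mod M" by simp
      show ?thesis
      proof (cases "n mod M = 0")
        case True
        then have "n div M * M \<le> D * M" using eq D by simp
        then show ?thesis using True n by simp
      next
        case False
        then have "n mod M > 0" using n pos_mod_sign[of M n] by linarith
        then have "n div M * M < D * M" using eq D by linarith
        then show ?thesis using False n by simp
      qed
    qed
    finally show ?thesis .
  qed
qed

lemma reduce_positive: "1 \<le> s \<Longrightarrow> s \<le> M \<Longrightarrow> (\<lambda>j. unit (r s) j - s * unit (r 1) j) \<in> int_span short_basis"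
proof (induction s rule: int_ge_induct)
  case base
  then show ?case using int_span_0 by simp
next
  case (step s)
  then have S: "s + 1 \<in> S" using S_pos(2)[of "s + 1"] by simp
  have IH: "(\<lambda>j. unit (r s) j - s * unit (r 1) j) \<in> int_span short_basis" using step by simp
  have "short_basis (r (s + 1)) = (\<lambda>j. unit (r (s + 1)) j - unit (r s) j - unit (r 1) j)"
    using step.hyps r[OF S] by (simp add: short_basis_def fun_eq_iff)
  from int_span_add[OF int_span_base[of short_basis "r (s + 1)", unfolded this] IH] show ?case
    by (simp add: algebra_simps)
qed

text \<open>
  Telescoping over the basis vectors of the distinguished coordinates gives the positive weights. The
  distinguished coordinate of a negative weight is minus that of the opposite weight up to a basis
  vector, and any other coordinate differs by a basis vector from the distinguished one.
\<close>

lemma reduce: "(\<lambda>j. unit i j - \<theta> i * unit (r 1) j) \<in> int_span short_basis"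
proof -
  have rep: "(\<lambda>j. unit (r s) j - s * unit (r 1) j) \<in> int_span short_basis" if s: "s \<in> S" for s
  proof (cases "s > 0")
    case True
    then show ?thesis using S_neg[OF s] by (intro reduce_positive) auto
  next
    case False
    then have neg: "s < 0" using S_pos(1)[OF s] by simp
    have "short_basis (r s) = (\<lambda>j. unit (r s) j + unit (r (- s)) j)"
      using neg r[OF s] by (simp add: short_basis_def fun_eq_iff)
    moreover have "(\<lambda>j. unit (r (- s)) j - (- s) * unit (r 1) j) \<in> int_span short_basis"
      using neg S_neg[OF s] by (intro reduce_positive) auto
    ultimately show ?thesis
      using int_span_diff[OF int_span_base[of short_basis "r s"]] by (fastforce simp: algebra_simps)
  qed
  show ?thesis
  proof (cases "\<theta> i = 0")
    case True
    then have "short_basis i = unit i" by (simp add: short_basis_def fun_eq_iff)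
    then show ?thesis using True int_span_base[of short_basis i] by simp
  next
    case False
    then have S: "\<theta> i \<in> S" using \<theta>_in by blast
    show ?thesis
    proof (cases "r (\<theta> i) = i")
      case True
      then show ?thesis using rep[OF S] by simp
    next
      case ne: False
      have "short_basis i = (\<lambda>j. unit i j - unit (r (\<theta> i)) j)"
        using False ne by (simp add: short_basis_def fun_eq_iff)
      from int_span_add[OF int_span_base[of short_basis i, unfolded this] rep[OF S]] show ?thesis by simp
    qed
  qed
qed

text \<open>
  Reducing the vector of \<open>r 1\<close> to the coordinate \<open>r 1\<close> gives \<open>(n div M) * M + n mod M = n\<close> times it.
\<close>

lemma n_multiple: "(\<lambda>j. n * unit (r 1) j) \<in> int_span short_basis"
proof -
  let ?q = "n div M" and ?t = "n mod M"
  let ?e = "\<lambda>j. short_basis (r 1) j - ?q * (unit (r M) j - M * unit (r 1) j) -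
      (if ?t = 0 then 0 else unit (r ?t) j - ?t * unit (r 1) j)"
  have M: "(\<lambda>j. unit (r M) j - M * unit (r 1) j) \<in> int_span short_basis"
    using reduce[of "r M"] by (simp add: r M_in_S)
  have t: "(\<lambda>j. if ?t = 0 then 0 else unit (r ?t) j - ?t * unit (r 1) j) \<in> int_span short_basis"
    using reduce[of "r ?t"] int_span_0 r[OF n_mod_M] by (cases "?t = 0") auto
  have "?e \<in> int_span short_basis"
    by (rule int_span_diff[OF int_span_diff[OF int_span_base[of short_basis "r 1"] int_span_scale[OF M, of ?q]] t])
  moreover have "?e = (\<lambda>j. n * unit (r 1) j)"
  proof
    fix j
    have "?q * M * unit (r 1) j + ?t * unit (r 1) j = n * unit (r 1) j"
      unfolding distrib_right[symmetric] by simp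
    then show "?e j = n * unit (r 1) j" by (auto simp: short_basis_r1 right_diff_distrib mult.assoc)
  qed
  ultimately show ?thesis by simp
qed

lemma short_basis_generates:
  assumes "n dvd (\<Sum>i\<in>UNIV. \<theta> i * e i)"
  shows "e \<in> int_span short_basis"
proof -
  obtain k where k: "(\<Sum>i\<in>UNIV. \<theta> i * e i) = n * k" using assms by (auto elim: dvdE)
  have "(\<lambda>j. (\<Sum>i\<in>UNIV. e i * (unit i j - \<theta> i * unit (r 1) j)) + k * (n * unit (r 1) j)) \<in> int_span short_basis"
    by (intro int_span_add int_span_sum int_span_scale reduce n_multiple)
  also have "(\<lambda>j. (\<Sum>i\<in>UNIV. e i * (unit i j - \<theta> i * unit (r 1) j)) + k * (n * unit (r 1) j)) = e"
  proof
    fix j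
    have "(\<Sum>i\<in>UNIV. e i * unit i j) = (\<Sum>i\<in>UNIV. e i * unit j i)"
      by (intro sum.cong refl) (simp add: unit_def)
    moreover have "(\<Sum>i\<in>UNIV. e i * (\<theta> i * unit (r 1) j)) = (n * k) * unit (r 1) j"
      unfolding k[symmetric] sum_distrib_right by (simp add: mult_ac)
    ultimately have "(\<Sum>i\<in>UNIV. e i * (unit i j - \<theta> i * unit (r 1) j)) = e j - (n * k) * unit (r 1) j"
      by (simp add: right_diff_distrib sum_subtractf sum_unit)
    then show "(\<Sum>i\<in>UNIV. e i * (unit i j - \<theta> i * unit (r 1) j)) + k * (n * unit (r 1) j) = e j"
      by (simp add: algebra_simps)
  qed
  finally show ?thesis .
qed

text \<open>
  The lattice contains \<open>n\<close> times every unit vector, so a generating family with as many members as there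
  are coordinates is independent.
\<close>

lemma short_basis_independent:
  assumes "\<And>k. (\<Sum>i\<in>UNIV. d i * short_basis i k) = 0"
  shows "d = (\<lambda>i. 0)"
proof (rule rows_independent_if_multiples_spanned[of "nat n" short_basis])
  fix j
  have "(\<lambda>k. n * unit j k) \<in> int_span short_basis"
    by (rule short_basis_generates) (simp add: mult.left_commute[of _ n] sum_distrib_left[symmetric] sum_unit)
  then show "\<exists>c. \<forall>k. (\<Sum>i\<in>UNIV. c i * short_basis i k) = (if k = j then int (nat n) else 0)"
  proof -
    assume "(\<lambda>k. n * unit j k) \<in> int_span short_basis"
    then obtain c where c: "(\<lambda>k. n * unit j k) = (\<lambda>k. \<Sum>i\<in>UNIV. c i * short_basis i k)"
      by (auto simp: int_span_def)
    have "(\<Sum>i\<in>UNIV. c i * short_basis i k) = (if k = j then int (nat n) else 0)" for k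
      using fun_cong[OF c, of k] n by (simp add: unit_def split: if_splits)
    then show ?thesis by blast
  qed
qed (use n assms in auto)

text \<open>
  The weight of a vector of norm at most \<open>d\<close> is at most \<open>d * M\<close> in absolute value.
\<close>

lemma short_invariants_homogeneous:
  assumes D: "int d * M < n" and e: "(\<Sum>i\<in>UNIV. \<bar>e i\<bar>) \<le> int d" "n dvd (\<Sum>i\<in>UNIV. \<theta> i * e i)"
  shows "(\<Sum>i\<in>UNIV. \<theta> i * e i) = 0"
proof -
  have "\<bar>\<theta> i\<bar> \<le> M" for i using \<theta>_in[of i] S_neg[of "\<theta> i"] n by auto
  then have "\<bar>\<Sum>i\<in>UNIV. \<theta> i * e i\<bar> \<le> (\<Sum>i\<in>UNIV. M * \<bar>e i\<bar>)"
    by (intro order_trans[OF sum_abs] sum_mono) (simp add: abs_mult mult_right_mono)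
  also have "\<dots> = M * (\<Sum>i\<in>UNIV. \<bar>e i\<bar>)" by (rule sum_distrib_left[symmetric])
  also have "\<dots> \<le> M * int d" using e(1) n by (intro mult_left_mono) auto
  finally show ?thesis
    using int_dvd_small_imp_zero[OF e(2)] D by (simp add: mult.commute)
qed

text \<open>
  For \<open>n = 2 * M\<close> the previous lemma only reaches norm 1, since doubling the coordinate of weight \<open>M\<close>
  gives a lattice vector of norm 2. Counting coordinates of weight 1 and -1 with signs is
  insensitive to this vector, as \<open>M > 1\<close>. If the count were nonzero, then a
  vector of norm 2 would either be supported on weights 1 and -1, so that the count is its weight,
  divisible by \<open>n > 2\<close> but at most 2 in absolute value, or it would combine a coordinate of weight 1 or -1 with one of
  another weight, and the total weight would be nonzero but smaller than \<open>n\<close> in absolute value.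
\<close>

lemma degree_two_invariants_balanced:
  assumes e: "(\<Sum>i\<in>UNIV. \<bar>e i\<bar>) \<le> 2" "n dvd (\<Sum>i\<in>UNIV. \<theta> i * e i)"
  shows "(\<Sum>i\<in>UNIV. (if \<theta> i = 1 then 1 else if \<theta> i = - 1 then - 1 else 0) * e i) = 0"
proof -
  let ?\<omega> = "\<lambda>i. if \<theta> i = 1 then 1 else if \<theta> i = - 1 then - 1 else 0 :: int"
  let ?w = "\<Sum>i\<in>UNIV. ?\<omega> i * e i"
  have bound: "\<bar>\<theta> i\<bar> \<le> M" for i using \<theta>_in[of i] S_neg[of "\<theta> i"] n by auto
  show ?thesis
  proof (cases "\<exists>i0. \<bar>\<theta> i0\<bar> \<noteq> 1 \<and> e i0 \<noteq> 0")
    case False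
    then have eq: "(\<Sum>i\<in>UNIV. \<theta> i * e i) = ?w"
      by (intro sum.cong refl) (auto simp: abs_if split: if_splits)
    have "\<bar>?w\<bar> \<le> (\<Sum>i\<in>UNIV. \<bar>e i\<bar>)"
      by (intro order_trans[OF sum_abs] sum_mono) auto
    then have "\<bar>?w\<bar> < n" using e(1) n by linarith
    then show ?thesis using int_dvd_small_imp_zero e(2) unfolding eq by blast
  next
    case True
    then obtain i0 where i0: "\<bar>\<theta> i0\<bar> \<noteq> 1" "e i0 \<noteq> 0" by blast
    let ?rest = "UNIV - {i0}"
    have split: "(\<Sum>i\<in>UNIV. f i) = f i0 + (\<Sum>i\<in>?rest. f i)" for f :: "'v \<Rightarrow> int"
      by (rule sum.remove) auto
    have norm: "\<bar>e i0\<bar> + (\<Sum>i\<in>?rest. \<bar>e i\<bar>) \<le> 2" using e(1) by (simp add: split)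
    have w: "?w = (\<Sum>i\<in>?rest. ?\<omega> i * e i)" using i0(1) by (auto simp: split[of "\<lambda>i. ?\<omega> i * e i"])
    have w_le: "\<bar>?w\<bar> \<le> (\<Sum>i\<in>?rest. \<bar>e i\<bar>)"
      unfolding w by (intro order_trans[OF sum_abs] sum_mono) auto
    show ?thesis
    proof (rule ccontr)
      assume nz: "?w \<noteq> 0"
      then have "(\<Sum>i\<in>?rest. \<bar>e i\<bar>) \<ge> 1" using w_le by linarith
      then have e0: "\<bar>e i0\<bar> = 1" and rest: "(\<Sum>i\<in>?rest. \<bar>e i\<bar>) = 1" using norm i0(2) by linarith+
      have w1: "\<bar>?w\<bar> = 1" using nz w_le rest by linarith
      obtain i1 where i1: "i1 \<in> ?rest" "?\<omega> i1 * e i1 \<noteq> 0"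
        using nz unfolding w by (metis (no_types, lifting) sum.neutral)
      have rest1: "(\<Sum>i\<in>?rest. \<bar>e i\<bar>) = \<bar>e i1\<bar> + (\<Sum>i\<in>?rest - {i1}. \<bar>e i\<bar>)"
        by (rule sum.remove) (use i1 in auto)
      have "\<bar>e i1\<bar> \<ge> 1" using i1(2) by (cases "e i1 = 0") auto
      moreover have "(\<Sum>i\<in>?rest - {i1}. \<bar>e i\<bar>) \<ge> 0" by (rule sum_nonneg) auto
      ultimately have "(\<Sum>i\<in>?rest - {i1}. \<bar>e i\<bar>) = 0" and e1: "\<bar>e i1\<bar> = 1" using rest rest1 by linarith+
      then have "e i = 0" if "i \<in> ?rest - {i1}" for i
        using that by (subst (asm) sum_nonneg_eq_0_iff) auto
      then have "(\<Sum>i\<in>?rest. \<theta> i * e i) = \<theta> i1 * e i1"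
        using i1(1) by (subst sum.remove[of _ i1]) auto
      then have total: "(\<Sum>i\<in>UNIV. \<theta> i * e i) = \<theta> i0 * e i0 + \<theta> i1 * e i1"
        by (simp add: split[of "\<lambda>i. \<theta> i * e i"])
      have \<theta>1: "\<bar>\<theta> i1\<bar> = 1" using i1(2) by (auto split: if_splits)
      have a: "\<bar>\<theta> i1 * e i1\<bar> = 1" using \<theta>1 e1 by (simp add: abs_mult)
      have b: "\<bar>\<theta> i0 * e i0\<bar> = \<bar>\<theta> i0\<bar>" using e0 by (simp add: abs_mult)
      have "\<theta> i0 * e i0 + \<theta> i1 * e i1 \<noteq> 0" using a b i0(1) by linarith
      moreover have "\<bar>\<theta> i0 * e i0 + \<theta> i1 * e i1\<bar> < n" using a b bound[of i0] n by linarith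
      ultimately show False using int_dvd_small_imp_zero e(2) unfolding total by blast
    qed
  qed
qed

end

section \<open>The two degree bounds\<close>

context diagonal_representation
begin

text \<open>
  A short basis of the lattice of invariant exponents bounds both field degrees at once: its Laurent
  monomials generate the invariants, and as they are independent they already form a transcendence basis.
\<close>

lemma generated_by_independent_laurent_monomials:
  assumes u: "\<And>i. int n dvd (\<Sum>j\<in>UNIV. \<theta> j * u i j)" "\<And>i. (\<Sum>j\<in>UNIV. \<bar>u i j\<bar>) \<le> int D"
    and gen: "\<And>e. int n dvd (\<Sum>i\<in>UNIV. \<theta> i * e i) \<Longrightarrow> e \<in> int_span u"
    and indep: "\<And>d. (\<And>k. (\<Sum>i\<in>UNIV. d i * u i k) = 0) \<Longrightarrow> d = (\<lambda>i. 0)"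
  defines "T \<equiv> range (\<lambda>i. laurent (u i))"
  shows "T \<subseteq> invariants_le G \<rho> D" "transcendence_basis T (invariants G \<rho>)"
    and "adjoin (invariants_le G \<rho> D) = invariants G \<rho>"
proof -
  have T_inv: "T \<subseteq> invariants G \<rho>"
    unfolding T_def invariants_eq_wfield using u(1) by (auto intro: laurent_in_wfield)
  have "ratfun_degree (laurent (u i)) \<le> D" for i
    using ratfun_degree_laurent_le[of "u i"] u(2)[of i] by linarith
  with T_inv show T_le: "T \<subseteq> invariants_le G \<rho> D"
    by (auto simp: T_def invariants_le_def)
  have "invariants G \<rho> \<subseteq> adjoin T"
    unfolding invariants_eq_wfield
  proof (rule wfield_subset_adjoin)
    fix e assume "int n dvd (\<Sum>i\<in>UNIV. \<theta> i * e i)"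
    then obtain c where "e = (\<lambda>k. \<Sum>i\<in>UNIV. c i * u i k)" using gen by (auto simp: int_span_def)
    then have "laurent e = (\<Prod>i\<in>UNIV. laurent (u i) powi c i)" by (simp add: laurent_sum laurent_scale)
    also have "\<dots> \<in> adjoin T" by (intro adjoin_prod adjoin_power_int adjoin_incl) (simp add: T_def)
    finally show "laurent e \<in> adjoin T" .
  qed
  moreover have "adjoin T \<subseteq> adjoin (invariants_le G \<rho> D)" by (rule adjoin_mono) (rule T_le)
  moreover have "adjoin (invariants_le G \<rho> D) \<subseteq> invariants G \<rho>"
    unfolding invariants_eq_wfield
    by (rule adjoin_subset_wfield) (auto simp: invariants_le_def simp flip: invariants_eq_wfield)
  ultimately show "adjoin (invariants_le G \<rho> D) = invariants G \<rho>" by blast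
  show "transcendence_basis T (invariants G \<rho>)"
    unfolding transcendence_basis_def
  proof (intro conjI ballI)
    show "algebraically_independent T"
      unfolding T_def by (rule algebraically_independent_laurent) (rule indep)
    show "ring.algebraic ring_of_type_algebra (adjoin T) f" if "f \<in> invariants G \<rho>" for f
      using that \<open>invariants G \<rho> \<subseteq> adjoin T\<close> by (intro algebraic_adjoin_self) blast
  qed (rule T_inv)
qed

lemma degree_bounds_interval_weights:
  assumes iw: "interval_weights (int n) M S \<theta> r"
    and D: "3 \<le> D" "int n \<le> int D * M" "\<And>d. d < D \<Longrightarrow> 3 \<le> d \<Longrightarrow> int d * M < int n"
  shows "beta_field G \<rho> = D" "gamma_field G \<rho> = D"
proof -
  interpret interval_weights "int n" M S \<theta> r by (rule iw)
  have upper: "range (\<lambda>i. laurent (short_basis i)) \<subseteq> invariants_le G \<rho> D"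
    "transcendence_basis (range (\<lambda>i. laurent (short_basis i))) (invariants G \<rho>)"
    "adjoin (invariants_le G \<rho> D) = invariants G \<rho>"
    using generated_by_independent_laurent_monomials[OF short_basis_invariant short_basis_norm short_basis_generates short_basis_independent] D
    by auto
  have lower: "adjoin (invariants_le G \<rho> d) \<noteq> invariants G \<rho>"
    "T \<subseteq> invariants_le G \<rho> d \<Longrightarrow> \<not> transcendence_basis T (invariants G \<rho>)" if "d < D" for d T
  proof -
    have "\<exists>\<omega>. \<omega> (r 1) \<noteq> 0 \<and> (\<forall>e. (\<Sum>i\<in>UNIV. \<bar>e i\<bar>) \<le> int d \<longrightarrow>
        int n dvd (\<Sum>i\<in>UNIV. \<theta> i * e i) \<longrightarrow> (\<Sum>i\<in>UNIV. \<omega> i * e i) = 0)"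
    proof (cases "d \<ge> 3")
      case True
      with D(3)[OF that] have "int d * M < int n" by simp
      then show ?thesis
        using short_invariants_homogeneous \<theta>_r1 by (intro exI[of _ \<theta>]) auto
    next
      case False
      then show ?thesis
        using degree_two_invariants_balanced \<theta>_r1
        by (intro exI[of _ "\<lambda>i. if \<theta> i = 1 then 1 else if \<theta> i = - 1 then - 1 else 0"]) auto
    qed
    then obtain \<omega> where \<omega>: "\<omega> (r 1) \<noteq> 0" "\<And>e. (\<Sum>i\<in>UNIV. \<bar>e i\<bar>) \<le> int d \<Longrightarrow>
        int n dvd (\<Sum>i\<in>UNIV. \<theta> i * e i) \<Longrightarrow> (\<Sum>i\<in>UNIV. \<omega> i * e i) = 0" by blast
    show "adjoin (invariants_le G \<rho> d) \<noteq> invariants G \<rho>"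
      by (rule low_degree_invariants_not_generating(1)[OF \<omega>(2,1)])
    show "T \<subseteq> invariants_le G \<rho> d \<Longrightarrow> \<not> transcendence_basis T (invariants G \<rho>)"
      by (rule low_degree_invariants_not_generating(2)[OF \<omega>(2,1)])
  qed
  show "beta_field G \<rho> = D"
    unfolding beta_field_def
    by (rule cInf_eq_minimum) (use D upper(3) lower(1) in \<open>auto simp: linorder_not_less[symmetric]\<close>)
  show "gamma_field G \<rho> = D"
    unfolding gamma_field_def
    by (rule cInf_eq_minimum) (use D upper(1,2) lower(2) in \<open>auto simp: linorder_not_less[symmetric]\<close>)
qed

end

lemma S_set_iff:
  "s \<in> S_set m \<longleftrightarrow> s \<noteq> 0 \<and> - (int m div 2) \<le> s \<and> s \<le> (int m + 1) div 2"
proof (cases "even m")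
  case True
  then obtain k where "m = 2 * k" by (auto elim: evenE)
  then show ?thesis by (auto simp: S_set_def image_iff)
next
  case False
  then obtain k where "m = 2 * k + 1" by (auto elim: oddE)
  then show ?thesis by (auto simp: S_set_def image_iff)
qed

lemma int_character_apply:
  "g \<in> carrier (integer_mod_group n) \<Longrightarrow> int_character n \<zeta> k g = \<zeta> powi (k * g)"
  by (simp add: int_character_def)

lemma int_character_in_character_group:
  assumes "primitive_root_of_unity n \<zeta>"
  shows "int_character n \<zeta> k \<in> character_group (integer_mod_group n)"
proof -
  have n: "n > 0" using assms by (simp add: primitive_root_of_unity_def)
  have nz: "\<zeta> \<noteq> 0" using assms by (rule primitive_root_nonzero)
  have "\<zeta> powi (k * ((a + b) mod int n)) = \<zeta> powi (k * a) * \<zeta> powi (k * b)" for a b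
  proof -
    have "\<zeta> powi (k * ((a + b) mod int n)) = \<zeta> powi (k * (a + b))"
      unfolding primitive_root_powi_eq_iff[OF assms]
      by (simp add: minus_mod_eq_mult_div[symmetric] flip: right_diff_distrib)
         (metis dvd_minus_mod dvd_minus_iff dvd_mult minus_diff_eq)
    then show ?thesis by (simp add: distrib_left power_int_add nz)
  qed
  then show ?thesis
    using n nz by (auto simp: character_group_def int_character_def hom_def carrier_integer_mod_group)
qed

text \<open>
  The eigenvalues on the rows of \<open>L\<close> are dual characters, which bounds the weights from above by
  \<open>S_m \<union> {0}\<close>. Conversely, an eigenvector for a character of \<open>S_m\<close> is a combination of the rows, and
  each row with a nonzero coefficient has this same character. The members of \<open>S_m \<union> {0}\<close> lie in
  an interval of length \<open>m < n\<close>, so weights that agree modulo \<open>n\<close> are equal.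
\<close>

lemma interval_weights_of_dual_characters:
  fixes L :: "'k::field ^ 'v ^ 'v"
  assumes n: "n \<ge> 3" "1 \<le> m" "m < n" and root: "primitive_root_of_unity n \<zeta>"
    and dual: "dual_characters (integer_mod_group n) \<rho> - {trivial_character (integer_mod_group n)} =
           int_character n \<zeta> ` S_set m"
    and L: "invertible L" "\<And>g i. g \<in> carrier (integer_mod_group n) \<Longrightarrow>
       dual_action (integer_mod_group n) \<rho> g (L $ i) = \<zeta> powi (\<theta>' i * g) *s L $ i"
  obtains \<theta> r where "interval_weights (int n) ((int m + 1) div 2) (S_set m) \<theta> r"
    "\<And>g i. g \<in> carrier (integer_mod_group n) \<Longrightarrow> \<zeta> powi (\<theta>' i * g) = \<zeta> powi (\<theta> i * g)"
proof -
  let ?G = "integer_mod_group n"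
  obtain L' where L': "L ** L' = mat 1" "L' ** L = mat 1" using L(1) by (auto simp: invertible_def)
  have one: "1 \<in> carrier ?G" using n by simp
  have row_nz: "L $ i \<noteq> 0" for i
  proof
    assume "L $ i = 0"
    then have "axis i 1 = (0 :: 'k ^ 'v)"
      using matrix_mult_row[of L L' i] by (simp add: L' mat_1_row)
    then show False by (simp add: axis_eq_0_iff)
  qed
  have "\<exists>s. (s = 0 \<or> s \<in> S_set m) \<and> (\<forall>g\<in>carrier ?G. \<zeta> powi (\<theta>' i * g) = \<zeta> powi (s * g))" for i
  proof -
    have "int_character n \<zeta> (\<theta>' i) \<in> dual_characters ?G \<rho>"
      unfolding dual_characters_def
      using int_character_in_character_group[OF root] row_nz[of i] L(2)
      by (auto simp: int_character_apply intro!: exI[of _ "L $ i"])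
    then consider "int_character n \<zeta> (\<theta>' i) = trivial_character ?G"
      | s where "s \<in> S_set m" "int_character n \<zeta> (\<theta>' i) = int_character n \<zeta> s"
      using dual by blast
    then show ?thesis
    proof cases
      case 1
      have "\<zeta> powi (\<theta>' i * g) = 1" if "g \<in> carrier ?G" for g
        using fun_cong[OF 1, of g] that by (simp add: int_character_apply trivial_character_def)
      then show ?thesis by (intro exI[of _ 0]) simp
    next
      case 2
      have "\<zeta> powi (\<theta>' i * g) = \<zeta> powi (s * g)" if "g \<in> carrier ?G" for g
        using fun_cong[OF 2(2), of g] that by (simp add: int_character_apply)
      then show ?thesis using 2 by blast
    qed
  qed
  then obtain \<theta> where \<theta>: "\<And>i. \<theta> i = 0 \<or> \<theta> i \<in> S_set m"
    "\<And>g i. g \<in> carrier ?G \<Longrightarrow> \<zeta> powi (\<theta>' i * g) = \<zeta> powi (\<theta> i * g)" by metis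
  have "\<exists>i. \<theta> i = s" if s: "s \<in> S_set m" for s
  proof -
    have "int_character n \<zeta> s \<in> dual_characters ?G \<rho>" using dual s by blast
    then obtain l where l: "l \<noteq> 0" "\<And>g. g \<in> carrier ?G \<Longrightarrow> dual_action ?G \<rho> g l = int_character n \<zeta> s g *s l"
      by (auto simp: dual_characters_def)
    define c where "c = l v* L'"
    have l_eq: "l = c v* L" by (simp add: c_def vector_matrix_mul_assoc L')
    have comb: "c v* L = (\<Sum>i\<in>UNIV. c $ i *s L $ i)" for c
      by (simp add: vec_eq_iff vector_matrix_mult_def mult.commute)
    have "c \<noteq> 0" using l(1) l_eq by auto
    then obtain i where i: "c $ i \<noteq> 0" by (auto simp: vec_eq_iff)
    define A where "A = \<rho> (inv\<^bsub>?G\<^esub> 1)"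
    have row: "L $ i v* A = \<zeta> powi \<theta> i *s L $ i" for i
      using L(2)[OF one, of i] \<theta>(2)[OF one, of i] by (simp add: A_def dual_action_def)
    have "(\<chi> i. \<zeta> powi \<theta> i * c $ i) v* L = l v* A"
      unfolding l_eq comb vector_matrix_mult_sum vector_matrix_mult_scale row
      by (intro sum.cong refl) (simp add: vec_eq_iff)
    also have "\<dots> = (\<zeta> powi s *s c) v* L"
      using l(2)[OF one] int_character_apply[OF one, of \<zeta> s]
      by (simp add: A_def dual_action_def vector_matrix_mult_scale flip: l_eq)
    finally have "((\<chi> i. \<zeta> powi \<theta> i * c $ i) v* L) v* L' = ((\<zeta> powi s *s c) v* L) v* L'" by simp
    then have "(\<chi> i. \<zeta> powi \<theta> i * c $ i) = \<zeta> powi s *s c"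
      by (simp add: vector_matrix_mul_assoc L')
    then have "\<zeta> powi \<theta> i * c $ i = \<zeta> powi s * c $ i" by (simp add: vec_eq_iff)
    then have "int n dvd \<theta> i - s" using i primitive_root_powi_eq_iff[OF root] by simp
    moreover have "\<bar>\<theta> i - s\<bar> < int n"
      using \<theta>(1)[of i] s n(3) unfolding S_set_iff by linarith
    ultimately have "\<theta> i - s = 0" by (rule int_dvd_small_imp_zero)
    then show ?thesis by auto
  qed
  then obtain r where r: "\<And>s. s \<in> S_set m \<Longrightarrow> \<theta> (r s) = s" by metis
  have "interval_weights (int n) ((int m + 1) div 2) (S_set m) \<theta> r"
  proof
    show "3 \<le> int n" "1 \<le> (int m + 1) div 2" "2 * ((int m + 1) div 2) \<le> int n" using n by linarith+
    show "s \<noteq> 0" "\<bar>s\<bar> \<le> (int m + 1) div 2" if "s \<in> S_set m" for s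
      using that unfolding S_set_iff by linarith+
    show "s \<in> S_set m" if "1 \<le> s" "s \<le> (int m + 1) div 2" for s
      using that unfolding S_set_iff by linarith
  qed (use \<theta> r in auto)
  then show thesis using that \<theta>(2) by blast
qed

theorem proposition4p5:
  fixes n m :: nat
    and \<zeta> :: "'k::field"
    and \<rho> :: "int \<Rightarrow> 'k ^ 'v::{finite,linorder} ^ 'v::{finite,linorder}"
  assumes "n \<ge> 3" and "1 \<le> m" and "m < n"
    and "\<not> CHAR('k) dvd n"
    and "card {z::'k. z ^ n = 1} = n"
    and "primitive_root_of_unity n \<zeta>"
    and "\<rho> \<in> hom (integer_mod_group n) GL"
    and "dual_characters (integer_mod_group n) \<rho> - {trivial_character (integer_mod_group n)} =
           int_character n \<zeta> ` S_set m"
  shows "int (beta_field (integer_mod_group n) \<rho>) =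
           max 3 \<lceil>real n / real_of_int \<lceil>real m / 2\<rceil>\<rceil>
       \<and> int (gamma_field (integer_mod_group n) \<rho>) =
           max 3 \<lceil>real n / real_of_int \<lceil>real m / 2\<rceil>\<rceil>"
proof -
  have char: "of_nat n \<noteq> (0 :: 'k)" using assms(4) by (simp add: of_nat_eq_0_iff_char_dvd)
  obtain L :: "(('k, 'v) vec, 'v) vec" and \<theta>' where L: "invertible L" "\<And>g i. g \<in> carrier (integer_mod_group n) \<Longrightarrow>
       dual_action (integer_mod_group n) \<rho> g (L $ i) = \<zeta> powi (\<theta>' i * g) *s L $ i"
    using exists_eigenbasis[OF assms(6) char assms(7)] by metis
  obtain \<theta> r where iw: "interval_weights (int n) ((int m + 1) div 2) (S_set m) \<theta> r"
    and \<theta>: "\<And>g i. g \<in> carrier (integer_mod_group n) \<Longrightarrow> \<zeta> powi (\<theta>' i * g) = \<zeta> powi (\<theta> i * g)"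
    using interval_weights_of_dual_characters[OF assms(1-3,6,8) L] by metis
  obtain L' where L': "L ** L' = mat 1" "L' ** L = mat 1" using L(1) by (auto simp: invertible_def)
  interpret diagonal_representation "\<lambda>i. linear_form (L $ i)" "\<lambda>i. linear_form (L' $ i)" n \<zeta> \<rho> \<theta>
  proof (intro diagonal_representation.intro diagonal_representation_axioms.intro)
    show "linear_coordinates (\<lambda>i. linear_form (L $ i)) (\<lambda>i. linear_form (L' $ i))"
      by (rule linear_coordinates_matrix[OF L'])
    fix g i assume g: "g \<in> carrier (integer_mod_group n)"
    have "mpoly_action (integer_mod_group n) \<rho> g (linear_form (L $ i)) =
        linear_form (dual_action (integer_mod_group n) \<rho> g (L $ i))"
      unfolding mpoly_action_def psubst_def[symmetric] dual_action_def axis_vector_matrix_mult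
      by (rule psubst_linear_form_matrix)
    then show "mpoly_action (integer_mod_group n) \<rho> g (linear_form (L $ i)) =
        mpoly_const (\<zeta> powi (\<theta> i * g)) * linear_form (L $ i)"
      using L(2)[OF g, of i] by (simp add: linear_form_scale \<theta>[OF g])
  qed (use assms(6) char in auto)
  define M where "M = (int m + 1) div 2"
  define C where "C = \<lceil>real n / real_of_int M\<rceil>"
  have M: "\<lceil>real m / 2\<rceil> = M" "M \<ge> 1"
    using assms(2) by (simp_all add: M_def) (auto simp: ceiling_eq_iff)
  have C: "int n \<le> C * M" "(C - 1) * M < int n"
  proof -
    have "real n / real_of_int M \<le> real_of_int C" "real_of_int C - 1 < real n / real_of_int M"
      unfolding C_def by linarith+
    then have "real n \<le> real_of_int (C * M)" "real_of_int ((C - 1) * M) < real n"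
      using M(2) by (simp_all add: field_simps)
    then show "int n \<le> C * M" "(C - 1) * M < int n" by linarith+
  qed
  \<comment> \<open>The next facts are all that the bounds need from the rounding: \<open>D\<close> is the least number with \<open>3 \<le> D\<close> and \<open>n \<le> D * M\<close>.\<close>
  define D where "D = nat (max 3 C)"
  have D: "int D = max 3 C" by (simp add: D_def)
  have "3 \<le> D" using D by linarith
  moreover have "int n \<le> int D * M"
    using C(1) mult_right_mono[of C "int D" M] M(2) D by linarith
  moreover have "int d * M < int n" if "d < D" "3 \<le> d" for d
  proof -
    have "int d \<le> C - 1" using that D by linarith
    then have "int d * M \<le> (C - 1) * M" using M(2) by (intro mult_right_mono) auto
    with C(2) show ?thesis by linarith
  qed
  ultimately have "beta_field (integer_mod_group n) \<rho> = D" "gamma_field (integer_mod_group n) \<rho> = D"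
    using degree_bounds_interval_weights[OF iw[folded M_def]] by blast+
  then show ?thesis using D by (simp add: M(1) C_def)
qed

end
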